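(* For $\sigma\in\mathbb{C}$ not an eigenvalue of $\mathcal{H}$, the infinite-dimensional eigenvalue problem $\mathcal{R}_{\sigma}^{-1}\phi=\mu\phi$ satisfies the following three properties. 1. If $\lambda$ is an eigenvalue of $\mathcal{H}$, then $\mu=\frac{1}{\lambda^2-\sigma^2}$ is an eigenvalue of $\mathcal{R}_{\sigma}^{-1}$; and vice versa, if $\mu$ is an eigenvalue of $\mathcal{R}_{\sigma}^{-1}$, then $\pm\sqrt{\frac{1}{\mu}+\sigma^2}$ are eigenvalues of $\mathcal{H}$. 2. Let $\lambda\neq0$ and $-\lambda$ be simple eigenvalues of $\mathcal{H}$ with eigenfunctions $\varphi_{+}$ and $\varphi_{-}$, respectively. Then the eigenspace of $\mathcal{R}_{\sigma}^{-1}$ associated with $\mu=\frac{1}{\lambda^2-\sigma^2}$ is spanned by $\{\varphi_{+},\varphi_{-}\}$. 3. The eigenvalues of $\mathcal{R}_{\sigma}^{-1}$ have even (algebraic) multiplicity.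
   Context: Let $n,K$ be positive integers, $0<\tau_1<\dots<\tau_K<\infty$, and let $H_0,H_1,H_{-1},\dots,H_K,H_{-K}\in\mathbb{R}^{2n\times 2n}$. Let $J=\begin{bmatrix}0&I_n\\-I_n&0\end{bmatrix}$. Standing assumption: $(JH_0)^{\top}=JH_0$ and $(JH_{-k})^{\top}=JH_k$ for $k=1,\dots,K$. Let $X=C([-\tau_K,\tau_K],\mathbb{C}^{2n})$. The operator $\mathcal{H}:D(\mathcal{H})\subseteq X\to X$ is $\mathcal{H}\varphi=\varphi'$ with $$D(\mathcal{H})=\Big\{\varphi\in X:\varphi'\in X,\ \varphi'(0)=H_0\varphi(0)+\sum_{k=1}^K\big(H_{-k}\varphi(-\tau_k)+H_k\varphi(\tau_k)\big)\Big\}.$$ For $\sigma\in\mathbb{C}$, let $\mathcal{R}_{\sigma}=(\mathcal{H}-\sigma\mathcal{I}_X)(\mathcal{H}+\sigma\mathcal{I}_X)$, i.e. $\mathcal{R}_{\sigma}\varphi=\varphi''-\sigma^2\varphi$ with domain $D(\mathcal{R}_{\sigma})$ consisting of all $\varphi\in X$ with $\varphi',\varphi''\in X$ satisfying $$\varphi'(0)=H_0\varphi(0)+\sum_{k=1}^K\big(H_{-k}\varphi(-\tau_k)+H_k\varphi(\tau_k)\big),\qquad \varphi''(0)=H_0\varphi'(0)+\sum_{k=1}^K\big(H_{-k}\varphi'(-\tau_k)+H_k\varphi'(\tau_k)\big).$$ If $\sigma$ is not an eigenvalue of $\mathcal{H}$, then $\mathcal{R}_{\sigma}:D(\mathcal{R}_\sigma)\to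 X$ is invertible, with inverse $\mathcal{R}_{\sigma}^{-1}:X\to D(\mathcal{R}_{\sigma})\subseteq X$. An eigenvalue is simple if it has algebraic multiplicity one. For $\mathcal{H}$ this is equivalent to $\lambda$ being a simple eigenvalue of the nonlinear eigenvalue problem $M(\lambda)v=0$ (simple zero of $\det M$), where $M(\lambda)=\lambda I_{2n}-H_0-\sum_{k=1}^K(H_{-k}e^{-\lambda\tau_k}+H_ke^{\lambda\tau_k})$. *)

theory Defs
  imports "HOL-Analysis.Analysis" "HOL-Library.Function_Algebras" "HOL-Library.Extended_Nat"
begin

section \<open>Functions on the line as a complex vector space\<close>

definition cscale :: "complex \<Rightarrow> (real \<Rightarrow> complex ^ 'm) \<Rightarrow> (real \<Rightarrow> complex ^ 'm)"
  where "cscale c \<phi> = (\<lambda>t. c *s \<phi> t)"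

global_interpretation cfun: vector_space cscale
  by unfold_locales
     (auto simp: cscale_def plus_fun_def vector_add_ldistrib vector_sadd_rdistrib vector_smult_assoc)

text \<open>A function on \<open>[-T, T]\<close> is represented by its extension by zero to the whole line, so
  that equality of functions on the interval is equality in HOL and \<open>contfun T\<close>, which stands for
  \<open>C([-T, T], \<complex>\<^sup>m)\<close>, is a complex subspace of all functions.\<close>

definition contfun :: "real \<Rightarrow> (real \<Rightarrow> complex ^ 'm) set"
  where "contfun T = {\<phi>. continuous_on {-T..T} \<phi> \<and> (\<forall>t. t \<notin> {-T..T} \<longrightarrow> \<phi> t = 0)}"

text \<open>Differentiation on \<open>[-T, T]\<close>, one-sided at the end points.\<close>

definition dfun :: "real \<Rightarrow> (real \<Rightarrow> complex ^ 'm) \<Rightarrow> (real \<Rightarrow> complex ^ 'm)"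
  where "dfun T \<phi> = (\<lambda>t. if t \<in> {-T..T} then vector_derivative \<phi> (at t within {-T..T}) else 0)"

text \<open>\<open>\<phi>\<close> and \<open>\<phi>'\<close> both lie in \<open>X\<close>; differentiability is required explicitly because
  \<open>vector_derivative\<close> is total.\<close>

definition C1fun :: "real \<Rightarrow> (real \<Rightarrow> complex ^ 'm) set"
  where "C1fun T = {\<phi> \<in> contfun T.
    (\<forall>t\<in>{-T..T}. \<phi> differentiable (at t within {-T..T})) \<and> dfun T \<phi> \<in> contfun T}"


section \<open>Eigenvalues of an operator \<open>A\<close> with domain \<open>D\<close>\<close>

definition eigenspace ::
  "(real \<Rightarrow> complex ^ 'm) set \<Rightarrow> ((real \<Rightarrow> complex ^ 'm) \<Rightarrow> (real \<Rightarrow> complex ^ 'm)) \<Rightarrow> complex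
    \<Rightarrow> (real \<Rightarrow> complex ^ 'm) set"
  where "eigenspace D A \<nu> = {\<phi> \<in> D. A \<phi> = cscale \<nu> \<phi>}"

definition eigenfunction ::
  "(real \<Rightarrow> complex ^ 'm) set \<Rightarrow> ((real \<Rightarrow> complex ^ 'm) \<Rightarrow> (real \<Rightarrow> complex ^ 'm)) \<Rightarrow> complex
    \<Rightarrow> (real \<Rightarrow> complex ^ 'm) \<Rightarrow> bool"
  where "eigenfunction D A \<nu> \<phi> \<longleftrightarrow> \<phi> \<in> eigenspace D A \<nu> \<and> \<phi> \<noteq> 0"

definition eigenvalue ::
  "(real \<Rightarrow> complex ^ 'm) set \<Rightarrow> ((real \<Rightarrow> complex ^ 'm) \<Rightarrow> (real \<Rightarrow> complex ^ 'm)) \<Rightarrow> complex \<Rightarrow> bool"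
  where "eigenvalue D A \<nu> \<longleftrightarrow> (\<exists>\<phi>. eigenfunction D A \<nu> \<phi>)"

text \<open>\<open>ker_pow D A \<nu> j\<close> is the kernel of \<open>(A - \<nu>)\<^sup>j\<close> on its natural domain, the domain of \<open>A\<^sup>j\<close>.\<close>

primrec ker_pow ::
  "(real \<Rightarrow> complex ^ 'm) set \<Rightarrow> ((real \<Rightarrow> complex ^ 'm) \<Rightarrow> (real \<Rightarrow> complex ^ 'm)) \<Rightarrow> complex
    \<Rightarrow> nat \<Rightarrow> (real \<Rightarrow> complex ^ 'm) set"
  where
    "ker_pow D A \<nu> 0 = {0}"
  | "ker_pow D A \<nu> (Suc j) = {\<phi> \<in> D. A \<phi> - cscale \<nu> \<phi> \<in> ker_pow D A \<nu> j}"

text \<open>The algebraic multiplicity is the dimension of the generalised eigenspace. It is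
  \<open>enat\<close>-valued since the library's \<open>dim\<close> is 0 on spaces of infinite dimension.\<close>

definition alg_mult ::
  "(real \<Rightarrow> complex ^ 'm) set \<Rightarrow> ((real \<Rightarrow> complex ^ 'm) \<Rightarrow> (real \<Rightarrow> complex ^ 'm)) \<Rightarrow> complex \<Rightarrow> enat"
  where "alg_mult D A \<nu> =
    (let G = (\<Union>j. ker_pow D A \<nu> j)
     in if \<exists>B. finite B \<and> cfun.span B = G then enat (cfun.dim G) else \<infinity>)"

definition simple_eigenvalue ::
  "(real \<Rightarrow> complex ^ 'm) set \<Rightarrow> ((real \<Rightarrow> complex ^ 'm) \<Rightarrow> (real \<Rightarrow> complex ^ 'm)) \<Rightarrow> complex \<Rightarrow> bool"
  where "simple_eigenvalue D A \<nu> \<longleftrightarrow> eigenvalue D A \<nu> \<and> alg_mult D A \<nu> = 1"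


section \<open>The operators \<open>\<H>\<close> and \<open>\<R>\<^sub>\<sigma>\<close>\<close>

text \<open>Vectors of length \<open>2n\<close> are indexed by \<open>'n + 'n\<close>: \<open>Inl\<close> is the first block of \<open>n\<close> indices,
  \<open>Inr\<close> the second.\<close>

definition symplJ :: "real ^ ('n::finite + 'n) ^ ('n + 'n)"
  where "symplJ = (\<chi> i j. case (i, j) of
      (Inl a, Inr b) \<Rightarrow> (if a = b then 1 else 0)
    | (Inr a, Inl b) \<Rightarrow> (if a = b then - 1 else 0)
    | _ \<Rightarrow> 0)"

definition cmat :: "real ^ 'm ^ 'm \<Rightarrow> complex ^ 'm ^ 'm"
  where "cmat A = (\<chi> i j. complex_of_real (A $ i $ j))"

text \<open>The nonlocal condition at \<open>0\<close>, with \<open>\<psi>\<close> in the place of \<open>\<phi>'\<close>.\<close>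

definition Hcond :: "nat \<Rightarrow> (nat \<Rightarrow> real) \<Rightarrow> (int \<Rightarrow> real ^ 'm ^ 'm)
    \<Rightarrow> (real \<Rightarrow> complex ^ 'm) \<Rightarrow> (real \<Rightarrow> complex ^ 'm) \<Rightarrow> bool"
  where "Hcond K \<tau> H \<phi> \<psi> \<longleftrightarrow>
    \<psi> 0 = cmat (H 0) *v \<phi> 0
      + (\<Sum>k=1..K. cmat (H (- int k)) *v \<phi> (- \<tau> k) + cmat (H (int k)) *v \<phi> (\<tau> k))"

definition domH :: "nat \<Rightarrow> (nat \<Rightarrow> real) \<Rightarrow> (int \<Rightarrow> real ^ 'm ^ 'm) \<Rightarrow> (real \<Rightarrow> complex ^ 'm) set"
  where "domH K \<tau> H = {\<phi> \<in> C1fun (\<tau> K). Hcond K \<tau> H \<phi> (dfun (\<tau> K) \<phi>)}"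

definition opH :: "nat \<Rightarrow> (nat \<Rightarrow> real) \<Rightarrow> (real \<Rightarrow> complex ^ 'm) \<Rightarrow> (real \<Rightarrow> complex ^ 'm)"
  where "opH K \<tau> \<phi> = dfun (\<tau> K) \<phi>"

definition domR :: "nat \<Rightarrow> (nat \<Rightarrow> real) \<Rightarrow> (int \<Rightarrow> real ^ 'm ^ 'm) \<Rightarrow> (real \<Rightarrow> complex ^ 'm) set"
  where "domR K \<tau> H = {\<phi> \<in> C1fun (\<tau> K). dfun (\<tau> K) \<phi> \<in> C1fun (\<tau> K)
    \<and> Hcond K \<tau> H \<phi> (dfun (\<tau> K) \<phi>)
    \<and> Hcond K \<tau> H (dfun (\<tau> K) \<phi>) (dfun (\<tau> K) (dfun (\<tau> K) \<phi>))}"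

definition opR :: "nat \<Rightarrow> (nat \<Rightarrow> real) \<Rightarrow> complex
    \<Rightarrow> (real \<Rightarrow> complex ^ 'm) \<Rightarrow> (real \<Rightarrow> complex ^ 'm)"
  where "opR K \<tau> \<sigma> \<phi> = dfun (\<tau> K) (dfun (\<tau> K) \<phi>) - cscale (\<sigma>\<^sup>2) \<phi>"

text \<open>The inverse of \<open>\<R>\<^sub>\<sigma> : D(\<R>\<^sub>\<sigma>) \<rightarrow> X\<close>, meaningful on its domain \<open>X = contfun (\<tau> K)\<close> when \<open>\<sigma>\<close> is
  not an eigenvalue of \<open>\<H>\<close>.\<close>

definition invR :: "nat \<Rightarrow> (nat \<Rightarrow> real) \<Rightarrow> (int \<Rightarrow> real ^ 'm ^ 'm) \<Rightarrow> complex
    \<Rightarrow> (real \<Rightarrow> complex ^ 'm) \<Rightarrow> (real \<Rightarrow> complex ^ 'm)"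
  where "invR K \<tau> H \<sigma> = inv_into (domR K \<tau> H) (opR K \<tau> \<sigma>)"

end

theory Submission
  imports Defs
begin

text \<open>The eigenvalue problem for \<open>\<R>\<^sub>\<sigma>\<^sup>-\<^sup>1\<close> is that of the square of \<open>\<H>\<close>. On suitably smooth functions, with
\<open>\<lambda>\<^sup>2 = 1/\<mu> + \<sigma>\<^sup>2\<close>, the equation \<open>\<R>\<^sub>\<sigma>\<^sup>-\<^sup>1 \<phi> = \<mu> \<phi>\<close> says \<open>(\<H> - \<lambda>)(\<H> + \<lambda>) \<phi> = 0\<close>. The Hamiltonian
symmetry enters through the characteristic matrix \<open>M(\<lambda>)\<close>: the transpose of \<open>J M(\<lambda>)\<close> is \<open>J M(-\<lambda>)\<close>
(\<open>transpose_J_symbol\<close>), so \<open>det M\<close> is an even function and the spectrum of \<open>\<H>\<close> is symmetric. Hence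
\<open>\<sigma>\<close> and \<open>-\<sigma>\<close> both lie outside it and \<open>\<R>\<^sub>\<sigma>\<close> is bijective, which gives the first property. The second
comes from the decomposition \<open>2\<lambda>\<phi> = (\<H> + \<lambda>)\<phi> - (\<H> - \<lambda>)\<phi>\<close>, whose two terms lie in the eigenspaces
of \<open>\<H>\<close> at \<open>\<lambda>\<close> and \<open>-\<lambda>\<close>.

For the third property let \<open>N\<^sub>j\<close> be the kernel of \<open>(\<R>\<^sub>\<sigma>\<^sup>-\<^sup>1 - \<mu>)\<^sup>j\<close>; with \<open>a = \<lambda>\<^sup>2\<close> it is the set
\<open>sq_kernel a j\<close> of all \<open>\<phi>\<close> with \<open>(D\<^sup>2 - a)\<^sup>j \<phi> = 0\<close> all of whose derivatives satisfy the nonlocal condition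
at \<open>0\<close> (\<open>ker_pow_invR\<close>). Two facts together show that the multiplicity is finite and even.

Every \<open>N\<^sub>j\<close> has even dimension (\<open>even_dim_sq_kernel\<close>). Without the nonlocal condition the solutions of
\<open>(D\<^sup>2 - a)\<^sup>j \<phi> = 0\<close> are exactly the functions \<open>\<Sum>l<2j. K\<^sub>j\<^bsup>(l)\<^esup> w\<^sub>l\<close> with unique vectors \<open>w\<^sub>l\<close>, where \<open>K\<^sub>j\<close> is the
scalar fundamental solution. The operator \<open>D\<^sup>2 - a\<close> is even in \<open>D\<close>, so \<open>K\<^sub>j\<close> is an odd function. Pairing
the coefficients of one solution, through \<open>J\<close>, with the defects of another in the nonlocal
condition gives a bilinear form whose radical is \<open>N\<^sub>j\<close>; by the oddness of \<open>K\<^sub>j\<close> and the symmetry of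
\<open>M\<close> it is alternating (\<open>pairing_skew\<close>). An alternating form has even rank, and the ambient space of
solutions has even dimension because it carries a nondegenerate alternating form as well. This argument
makes no distinction between \<open>\<lambda> = 0\<close> and \<open>\<lambda> \<noteq> 0\<close>.

The chain \<open>N\<^sub>j\<close> becomes constant (\<open>sq_kernel_stabilises\<close>). A Jordan chain of \<open>\<H>\<close> at \<open>\<nu>\<close> of length \<open>n\<close> is
a vector \<open>V\<close> of power series with \<open>V(0) \<noteq> 0\<close> for which \<open>M(\<nu> + X) V\<close> is divisible by \<open>X\<^sup>n\<close>. By Cramer's
rule \<open>X\<^sup>n\<close> then divides \<open>det M(\<nu> + X)\<close>, so \<open>n\<close> is at most the order of the zero of \<open>det M\<close> at \<open>\<nu>\<close>. That order
is finite because \<open>det M(\<sigma>) \<noteq> 0\<close>.\<close>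

section \<open>First-order equations on a symmetric interval\<close>

lemma norm_vsmult: "norm ((c::complex) *s (x::complex^'m)) = norm c * norm x"
  by (simp add: norm_vec_def norm_mult L2_set_right_distrib)

lemma bounded_bilinear_vsmult: "bounded_bilinear (\<lambda>(c::complex) (x::complex^'m). c *s x)"
proof
  show "(r *\<^sub>R c) *s x = r *\<^sub>R (c *s x)" "c *s (r *\<^sub>R x) = r *\<^sub>R (c *s x)"
    for r :: real and c :: complex and x :: "complex^'m"
    by (simp_all add: vec_eq_iff)
  show "\<exists>K. \<forall>c x. norm ((c::complex) *s (x::complex^'m)) \<le> norm c * norm x * K"
    by (rule exI[of _ 1]) (simp add: norm_vsmult)
qed (simp_all add: vector_sadd_rdistrib vector_add_ldistrib)

lemmas vsmult_has_vector_derivative =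
  bounded_bilinear.has_vector_derivative[OF bounded_bilinear_vsmult]
lemmas vsmult_continuous_on =
  bounded_bilinear.continuous_on[OF bounded_bilinear_vsmult]

text \<open>A smooth function on the line becomes an element of \<open>contfun T\<close> when it is cut off outside \<open>[-T, T]\<close>.\<close>

definition cutoff :: "real \<Rightarrow> (real \<Rightarrow> complex^'m) \<Rightarrow> (real \<Rightarrow> complex^'m)"
  where "cutoff T f = (\<lambda>t. if t \<in> {-T..T} then f t else 0)"

locale centred_interval =
  fixes T :: real
  assumes T_pos: "0 < T"
begin

lemma C1funI:
  assumes "\<And>t. t \<in> {-T..T} \<Longrightarrow> (\<phi> has_vector_derivative \<psi> t) (at t within {-T..T})"
    and "\<And>t. t \<notin> {-T..T} \<Longrightarrow> \<phi> t = 0" and "\<psi> \<in> contfun T"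
  shows "\<phi> \<in> C1fun T" "dfun T \<phi> = \<psi>"
proof -
  show d: "dfun T \<phi> = \<psi>"
    using assms T_pos by (auto simp: dfun_def contfun_def fun_eq_iff
        intro!: vector_derivative_within_closed_interval[of "-T" T])
  have "continuous_on {-T..T} \<phi>"
    using assms(1) has_vector_derivative_continuous continuous_on_eq_continuous_within by blast
  then show "\<phi> \<in> C1fun T"
    using assms(2,3) differentiableI_vector[OF assms(1)]
    by (simp add: C1fun_def d contfun_def)
qed

lemma C1funD:
  assumes "\<phi> \<in> C1fun T"
  shows "t \<in> {-T..T} \<Longrightarrow> (\<phi> has_vector_derivative dfun T \<phi> t) (at t within {-T..T})"
    and "t \<notin> {-T..T} \<Longrightarrow> \<phi> t = 0" and "dfun T \<phi> \<in> contfun T" and "\<phi> \<in> contfun T"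
  using assms by (auto simp: C1fun_def contfun_def dfun_def vector_derivative_works[symmetric])

lemma subspace_contfun: "cfun.subspace (contfun T)"
  unfolding contfun_def
  by (rule cfun.subspaceI)
     (auto simp: cscale_def plus_fun_def intro!: continuous_intros vsmult_continuous_on)

lemma C1fun_add:
  assumes "\<phi> \<in> C1fun T" "\<psi> \<in> C1fun T"
  shows "\<phi> + \<psi> \<in> C1fun T" "dfun T (\<phi> + \<psi>) = dfun T \<phi> + dfun T \<psi>"
proof -
  have *: "dfun T \<phi> + dfun T \<psi> \<in> contfun T"
    using C1funD(3) assms cfun.subspace_add[OF subspace_contfun] by blast
  have d: "(\<phi> + \<psi> has_vector_derivative (dfun T \<phi> + dfun T \<psi>) t) (at t within {-T..T})"
    if "t \<in> {-T..T}" for t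
    using that C1funD(1)[OF assms(1) that] C1funD(1)[OF assms(2) that]
    by (auto simp: plus_fun_def intro!: derivative_eq_intros)
  have z: "(\<phi> + \<psi>) t = 0" if "t \<notin> {-T..T}" for t
    using C1funD(2)[OF assms(1) that] C1funD(2)[OF assms(2) that] by simp
  show "\<phi> + \<psi> \<in> C1fun T" "dfun T (\<phi> + \<psi>) = dfun T \<phi> + dfun T \<psi>"
    by (rule C1funI(1)[OF d z *], assumption+) (rule C1funI(2)[OF d z *], assumption+)
qed

lemma C1fun_cscale:
  assumes "\<phi> \<in> C1fun T"
  shows "cscale c \<phi> \<in> C1fun T" "dfun T (cscale c \<phi>) = cscale c (dfun T \<phi>)"
proof -
  have *: "cscale c (dfun T \<phi>) \<in> contfun T"
    using C1funD(3) assms cfun.subspace_scale[OF subspace_contfun] by blast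
  have d: "(cscale c \<phi> has_vector_derivative cscale c (dfun T \<phi>) t) (at t within {-T..T})"
    if "t \<in> {-T..T}" for t
    using vsmult_has_vector_derivative[OF has_vector_derivative_const C1funD(1)[OF assms that], of c]
    by (simp add: cscale_def)
  have z: "cscale c \<phi> t = 0" if "t \<notin> {-T..T}" for t
    using C1funD(2)[OF assms that] by (simp add: cscale_def)
  show "cscale c \<phi> \<in> C1fun T" "dfun T (cscale c \<phi>) = cscale c (dfun T \<phi>)"
    by (rule C1funI(1)[OF d z *], assumption+) (rule C1funI(2)[OF d z *], assumption+)
qed

lemma C1fun_0: "0 \<in> C1fun T" "dfun T 0 = 0"
  using C1funI[of "0::real \<Rightarrow> complex^'m" 0] cfun.subspace_0[OF subspace_contfun]
  by (auto simp: zero_fun_def)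

lemma subspace_C1fun: "cfun.subspace (C1fun T)"
  by (rule cfun.subspaceI) (simp_all add: C1fun_0 C1fun_add C1fun_cscale)

lemma C1fun_diff:
  assumes "\<phi> \<in> C1fun T" "\<psi> \<in> C1fun T"
  shows "\<phi> - \<psi> \<in> C1fun T" "dfun T (\<phi> - \<psi>) = dfun T \<phi> - dfun T \<psi>"
proof -
  show *: "\<phi> - \<psi> \<in> C1fun T"
    using assms cfun.subspace_diff[OF subspace_C1fun] by blast
  have "dfun T \<phi> = dfun T ((\<phi> - \<psi>) + \<psi>)"
    by simp
  also have "\<dots> = dfun T (\<phi> - \<psi>) + dfun T \<psi>"
    using C1fun_add[OF * assms(2)] by simp
  finally show "dfun T (\<phi> - \<psi>) = dfun T \<phi> - dfun T \<psi>"
    by simp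
qed

lemma dfun_cutoff:
  assumes "\<And>t. (f has_vector_derivative f' t) (at t)" and "continuous_on UNIV f'"
  shows "cutoff T f \<in> C1fun T" "dfun T (cutoff T f) = cutoff T f'"
proof -
  have "continuous_on {-T..T} (cutoff T f')"
    using continuous_on_subset[OF assms(2), of "{-T..T}"]
    by (rule continuous_on_eq) (auto simp: cutoff_def)
  then have 1: "cutoff T f' \<in> contfun T"
    by (auto simp: contfun_def cutoff_def)
  have 2: "(cutoff T f has_vector_derivative cutoff T f' t) (at t within {-T..T})" 
    if "t \<in> {-T..T}" for t
    using has_vector_derivative_transform[OF that _ has_vector_derivative_at_within[OF assms(1)],
        of "cutoff T f"] that
    by (simp add: cutoff_def)
  have 3: "cutoff T f t = 0" if "t \<notin> {-T..T}" for t
    using that by (auto simp: cutoff_def)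
  show "cutoff T f \<in> C1fun T" "dfun T (cutoff T f) = cutoff T f'"
    by (rule C1funI(1)[OF 2 3 1], assumption+) (rule C1funI(2)[OF 2 3 1], assumption+)
qed

lemma cexp_has_vector_derivative:
  fixes \<nu> :: complex
  shows "((\<lambda>t. exp (\<nu> * of_real t)) has_vector_derivative \<nu> * exp (\<nu> * of_real t)) (at t within S)"
  by (rule has_vector_derivative_real_field[where f = "\<lambda>z. exp (\<nu> * z)"])
    (auto intro!: derivative_eq_intros)

definition expfun :: "complex \<Rightarrow> complex^'m \<Rightarrow> real \<Rightarrow> complex^'m"
  where "expfun \<nu> v = cutoff T (\<lambda>t. exp (\<nu> * of_real t) *s v)"

lemma expfun_0 [simp]: "expfun \<nu> v 0 = v"
  using T_pos by (simp add: expfun_def cutoff_def)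

lemma expfun_C1fun: "expfun \<nu> v \<in> C1fun T" "dfun T (expfun \<nu> v) = cscale \<nu> (expfun \<nu> v)"
proof -
  have 1: "((\<lambda>t. exp (\<nu> * of_real t) *s v) has_vector_derivative (\<nu> * exp (\<nu> * of_real t)) *s v) (at t)" for t
    using vsmult_has_vector_derivative[OF cexp_has_vector_derivative[of \<nu> t UNIV]
        has_vector_derivative_const[of v]]
    by simp
  have 2: "continuous_on UNIV (\<lambda>t. (\<nu> * exp (\<nu> * of_real t)) *s v)"
    by (intro vsmult_continuous_on continuous_intros)
  show "expfun \<nu> v \<in> C1fun T" "dfun T (expfun \<nu> v) = cscale \<nu> (expfun \<nu> v)"
    using dfun_cutoff[OF 1 2] 
    by (auto simp: expfun_def cutoff_def cscale_def fun_eq_iff vector_smult_assoc)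
qed

text \<open>The derivative of \<open>exp (- \<nu> t) y t\<close> vanishes, so this function is constant on the interval.\<close>

lemma first_order_solution:
  assumes y: "y \<in> C1fun T" and eq: "dfun T y = cscale \<nu> y"
  shows "y = expfun \<nu> (y 0)"
proof -
  have deriv: "((\<lambda>t. exp (- \<nu> * of_real t) *s y t) has_derivative (\<lambda>h. 0)) (at t within {-T..T})"
    if "t \<in> {-T..T}" for t
  proof -
    have "exp (- \<nu> * of_real t) *s dfun T y t + (- \<nu> * exp (- \<nu> * of_real t)) *s y t = 0"
      by (simp add: eq cscale_def vec_eq_iff)
    then show ?thesis
      using vsmult_has_vector_derivative[OF cexp_has_vector_derivative C1funD(1)[OF y that], of "-\<nu>"]
      by (simp add: has_vector_derivative_def)
  qed
  then obtain c where c: "\<And>t. t \<in> {-T..T} \<Longrightarrow> exp (- \<nu> * of_real t) *s y t = c"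
    using has_derivative_zero_constant[OF convex_real_interval(5) deriv] by metis
  from c[of 0] T_pos have "c = y 0" by simp
  show ?thesis
  proof
    fix t
    show "y t = expfun \<nu> (y 0) t"
    proof (cases "t \<in> {-T..T}")
      case True
      have "exp (\<nu> * of_real t) *s (exp (- \<nu> * of_real t) *s y t) = y t"
        by (simp add: vector_smult_assoc exp_minus)
      then have "y t = exp (\<nu> * of_real t) *s y 0"
        unfolding c[OF True] \<open>c = y 0\<close> ..
      then show ?thesis
        using True by (simp add: expfun_def cutoff_def)
    qed (use C1funD(2)[OF y] in \<open>auto simp: expfun_def cutoff_def\<close>)
  qed
qed

text \<open>Variation of constants: multiply an antiderivative of \<open>exp (- \<nu> t) f t\<close> by \<open>exp (\<nu> t)\<close>.\<close>

lemma first_order_solvable: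
  assumes "f \<in> contfun T"
  obtains g where "g \<in> C1fun T" "dfun T g = cscale \<nu> g + f"
proof -
  have cf: "continuous_on {-T..T} f" and f0: "\<And>t. t \<notin> {-T..T} \<Longrightarrow> f t = 0"
    using assms by (auto simp: contfun_def)
  have "continuous_on {-T..T} (\<lambda>t. exp (- \<nu> * of_real t) *s f t)"
    by (intro vsmult_continuous_on continuous_intros cf)
  then obtain h where h: "\<And>t. t \<in> {-T..T} \<Longrightarrow>
      (h has_vector_derivative exp (- \<nu> * of_real t) *s f t) (at t within {-T..T})"
    using antiderivative_continuous by blast
  define k where "k = (\<lambda>t. exp (\<nu> * of_real t) *s h t)"
  have k: "(k has_vector_derivative \<nu> *s k t + f t) (at t within {-T..T})" if "t \<in> {-T..T}" for t
  proof -
    have "(k has_vector_derivative exp (\<nu> * of_real t) *s (exp (- \<nu> * of_real t) *s f t)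
        + (\<nu> * exp (\<nu> * of_real t)) *s h t) (at t within {-T..T})"
      unfolding k_def by (rule vsmult_has_vector_derivative[OF cexp_has_vector_derivative h[OF that]])
    moreover have "exp (\<nu> * of_real t) *s (exp (- \<nu> * of_real t) *s f t)
        + (\<nu> * exp (\<nu> * of_real t)) *s h t = \<nu> *s k t + f t"
      by (simp add: k_def vector_smult_assoc exp_minus add.commute)
    ultimately show ?thesis by simp
  qed
  have "continuous_on {-T..T} k"
    using k has_vector_derivative_continuous continuous_on_eq_continuous_within by blast
  then have "continuous_on {-T..T} (cutoff T k)"
    by (rule continuous_on_eq) (simp add: cutoff_def)
  then have ck: "cutoff T k \<in> contfun T"
    by (auto simp: contfun_def cutoff_def)
  have 1: "(cutoff T k has_vector_derivative (cscale \<nu> (cutoff T k) + f) t) (at t within {-T..T})"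
    if "t \<in> {-T..T}" for t
    using has_vector_derivative_transform[OF that _ k[OF that], of "cutoff T k"] that
    by (simp add: cutoff_def cscale_def)
  have 2: "cscale \<nu> (cutoff T k) + f \<in> contfun T"
    using assms ck cfun.subspace_add cfun.subspace_scale subspace_contfun by blast
  show thesis
    by (rule that[of "cutoff T k"]; rule C1funI[OF 1 _ 2]) (auto simp: cutoff_def)
qed

end

section \<open>The parity of the rank of an alternating form\<close>

definition (in vector_space) alternating_on :: "'b set \<Rightarrow> ('b \<Rightarrow> 'b \<Rightarrow> 'a) \<Rightarrow> bool"
  where "alternating_on V B \<longleftrightarrow>
    (\<forall>x\<in>V. \<forall>y\<in>V. \<forall>z\<in>V. B (x + y) z = B x z + B y z) \<and>
    (\<forall>c. \<forall>x\<in>V. \<forall>y\<in>V. B (scale c x) y = c * B x y) \<and>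
    (\<forall>x\<in>V. \<forall>y\<in>V. B y x = - B x y) \<and> (\<forall>x\<in>V. B x x = 0)"

text \<open>The rank of an alternating form is even. As long as the form is not zero, a hyperbolic plane can be
split off; its orthogonal complement has dimension smaller by two and the same radical.\<close>

lemma (in vector_space) even_dim_iff_even_dim_radical:
  assumes "subspace V" "finite S" "V \<subseteq> span S" and B: "alternating_on V B"
  shows "even (dim V) \<longleftrightarrow> even (dim {x \<in> V. \<forall>y\<in>V. B x y = 0})"
  using assms
proof (induction "dim V" arbitrary: V rule: less_induct)
  case less
  note V = less.prems(1)
  have add: "B (x + y) z = B x z + B y z" if "x \<in> V" "y \<in> V" "z \<in> V" for x y z
    using less.prems(4) that unfolding alternating_on_def by blast
  have scl: "B (scale c x) y = c * B x y" if "x \<in> V" "y \<in> V" for c x y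
    using less.prems(4) that unfolding alternating_on_def by blast
  have skew: "B y x = - B x y" if "x \<in> V" "y \<in> V" for x y
    using less.prems(4) that unfolding alternating_on_def by blast
  have self: "B x x = 0" if "x \<in> V" for x
    using less.prems(4) that unfolding alternating_on_def by blast
  have V_add: "x + y \<in> V" and V_diff: "x - y \<in> V" if "x \<in> V" "y \<in> V" for x y
    using that V subspace_add subspace_diff by blast+
  have V_scl: "scale c x \<in> V" if "x \<in> V" for c x
    using that V subspace_scale by blast
  have diff: "B (x - y) z = B x z - B y z" if "x \<in> V" "y \<in> V" "z \<in> V" for x y z
    using add[of "x - y" y z] V_diff that by simp
  show ?case
  proof (cases "\<forall>x\<in>V. \<forall>y\<in>V. B x y = 0")
    case True
    then have "{x \<in> V. \<forall>y\<in>V. B x y = 0} = V" by auto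
    then show ?thesis by simp
  next
    case False
    then obtain u v0 where u: "u \<in> V" and v0: "v0 \<in> V" "B u v0 \<noteq> 0" by blast
    define v where "v = scale (inverse (B u v0)) v0"
    have v: "v \<in> V" using v0 V_scl v_def by blast
    have vu: "B v u = -1"
      using v0 u scl[of v0 u] skew[of u v0] by (simp add: v_def)
    then have uv: "B u v = 1"
      using skew[OF v u] by simp
    \<comment> \<open>\<open>V'\<close> is the orthogonal complement of the hyperbolic plane spanned by \<open>u\<close> and \<open>v\<close>.\<close>
    define V' where "V' = {x \<in> V. B x u = 0 \<and> B x v = 0}"
    have sub: "V' \<subseteq> V" by (auto simp: V'_def)
    have V': "subspace V'"
      using u v V_add V_scl subspace_0[OF V] scl[of u u 0] scl[of u v 0]
      by (intro subspaceI) (auto simp: V'_def add scl)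
    \<comment> \<open>the projection of \<open>x\<close> to \<open>V'\<close> along the hyperbolic plane\<close>
    have proj: "x - scale (B x v) u + scale (B x u) v \<in> V'" if x: "x \<in> V" for x
    proof -
      have [simp]: "scale c u \<in> V" "scale c v \<in> V" "x - scale c u \<in> V" for c
        using x u v V_scl V_diff by blast+
      show ?thesis
        using x u v by (simp add: V'_def V_add add diff scl uv vu self)
    qed
    have spanV': "span V' = V'" using V' by simp
    have u_notin: "u \<notin> span (insert v V')"
    proof
      assume "u \<in> span (insert v V')"
      then obtain k where "u - scale k v \<in> V'"
        unfolding span_breakdown_eq spanV' by blast
      then have "B (u - scale k v) v = 0" by (simp add: V'_def)
      then show False using u v V_scl by (simp add: diff scl uv self)
    qed
    have v_notin: "v \<notin> span V'"
      unfolding spanV' using vu by (simp add: V'_def)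
    obtain C where C: "C \<subseteq> V'" "independent C" "V' \<subseteq> span C" "card C = dim V'"
      by (rule basis_exists)
    have sC: "span C = V'"
      using C(1,3) span_mono[OF C(1)] spanV' by blast
    have finC: "finite C"
      using independent_span_bound[OF less.prems(2) C(2)] C(1) sub less.prems(3) by blast
    have insC: "span (insert v C) = span (insert v V')"
      by (simp add: span_insert sC spanV')
    have ind: "independent (insert u (insert v C))"
      using u_notin v_notin C(2) by (intro independent_insertI) (simp_all add: insC sC spanV')
    have spn: "V \<subseteq> span (insert u (insert v C))"
    proof
      fix x assume x: "x \<in> V"
      have "x - scale (B x v) u - scale (- B x u) v \<in> span C"
        using proj[OF x] sC by simp
      then show "x \<in> span (insert u (insert v C))"
        unfolding span_breakdown_eq by blast
    qed
    have "u \<notin> insert v C" "v \<notin> C"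
      using u_notin v_notin C(1) span_base[of u "insert v V'"] span_base[of v V'] by auto
    then have "card (insert u (insert v C)) = dim V' + 2"
      using finC C(4) by simp
    then have dimV: "dim V = dim V' + 2"
      using dim_unique[OF _ spn ind] u v C(1) sub by blast
    have "{x \<in> V. \<forall>y\<in>V. B x y = 0} = {x \<in> V'. \<forall>y\<in>V'. B x y = 0}"
    proof (intro subset_antisym subsetI)
      fix x assume "x \<in> {x \<in> V'. \<forall>y\<in>V'. B x y = 0}"
      then have x: "x \<in> V" "B x u = 0" "B x v = 0" and x': "\<And>y. y \<in> V' \<Longrightarrow> B x y = 0"
        by (auto simp: V'_def)
      have "B x y = 0" if y: "y \<in> V" for y
      proof -
        let ?p = "y - scale (B y v) u + scale (B y u) v"
        have [simp]: "scale c u \<in> V" "scale c v \<in> V" "y - scale c u \<in> V" for c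
          using y u v V_scl V_diff by blast+
        have xu: "B u x = 0" "B v x = 0" using x u v skew[OF x(1) u] skew[OF x(1) v] by simp_all
        have "B ?p x = B y x"
          using x y u v by (simp add: add diff scl xu)
        moreover have "B ?p x = - B x ?p"
          using skew[OF x(1)] proj[OF y] sub by blast
        ultimately show ?thesis
          using x'[OF proj[OF y]] skew[OF y x(1)] by simp
      qed
      with x show "x \<in> {x \<in> V. \<forall>y\<in>V. B x y = 0}" by blast
    qed (use u v in \<open>auto simp: V'_def\<close>)
    moreover have "even (dim V') \<longleftrightarrow> even (dim {x \<in> V'. \<forall>y\<in>V'. B x y = 0})"
    proof (rule less.hyps)
      show "alternating_on V' B"
        using less.prems(4) sub unfolding alternating_on_def by blast
    qed (use dimV V' sub less.prems in auto)
    ultimately show ?thesis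
      using dimV by simp
  qed
qed

section \<open>Fundamental solutions of powers of a second-order operator\<close>

text \<open>\<open>kcoef a j n\<close> is the derivative of order \<open>n\<close> at \<open>0\<close> of the fundamental solution \<open>K\<^sub>j\<close> of \<open>(D\<^sup>2 - a)\<^sup>j\<close>, the
solution whose first nonzero derivative at \<open>0\<close> is the one of order \<open>2j - 1\<close>, with value \<open>1\<close>. Thus
\<open>K\<^sub>1\<close> is \<open>sinh (\<lambda>t) / \<lambda>\<close> for \<open>a = \<lambda>\<^sup>2 \<noteq> 0\<close> and \<open>t\<close> for \<open>a = 0\<close>. Defining it by Taylor coefficients rather
than by exponentials treats both cases at once. The convention \<open>K\<^sub>0 = 0\<close> makes
\<open>(D\<^sup>2 - a) K\<^sub>j\<^sub>+\<^sub>1 = K\<^sub>j\<close> hold for every \<open>j\<close>.\<close>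

fun kcoef :: "complex \<Rightarrow> nat \<Rightarrow> nat \<Rightarrow> complex" where
  "kcoef a 0 n = 0"
| "kcoef a (Suc j) 0 = 0"
| "kcoef a (Suc j) (Suc 0) = (if j = 0 then 1 else 0)"
| "kcoef a (Suc j) (Suc (Suc n)) = a * kcoef a (Suc j) n + kcoef a j n"

lemma kcoef_bound: "norm (kcoef a j n) \<le> (1 + norm a) ^ n"
proof (induction a j n rule: kcoef.induct)
  case (4 a j n)
  have "norm (kcoef a (Suc j) (Suc (Suc n))) \<le> norm a * norm (kcoef a (Suc j) n) + norm (kcoef a j n)"
    using norm_triangle_ineq[of "a * kcoef a (Suc j) n"] by (simp add: norm_mult)
  also have "\<dots> \<le> norm a * (1 + norm a) ^ n + (1 + norm a) ^ n"
    using 4 by (intro add_mono mult_left_mono) auto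
  also have "\<dots> = (1 + norm a) ^ Suc n"
    by (simp add: algebra_simps)
  also have "\<dots> \<le> (1 + norm a) ^ Suc (Suc n)"
    by (intro power_increasing) auto
  finally show ?case .
qed auto

lemma kcoef_even: "even n \<Longrightarrow> kcoef a j n = 0"
  by (induction a j n rule: kcoef.induct) auto

lemma kcoef_low: "Suc n < 2 * j \<Longrightarrow> kcoef a j n = 0"
  by (induction a j n rule: kcoef.induct) auto

lemma kcoef_lead: "kcoef a (Suc j) (Suc (2 * j)) = 1"
  by (induction j) (auto simp: kcoef_low)

text \<open>The derivative of order \<open>l\<close> of the fundamental solution \<open>K\<^sub>j\<close>.\<close>

definition ksol :: "complex \<Rightarrow> nat \<Rightarrow> nat \<Rightarrow> complex \<Rightarrow> complex"
  where "ksol a j l z = (\<Sum>n. kcoef a j (n + l) / fact n * z ^ n)"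

lemma ksol_summable: "summable (\<lambda>n. kcoef a j (n + l) / fact n * z ^ n)"
proof (rule summable_comparison_test)
  let ?r = "1 + norm a"
  show "summable (\<lambda>n. ?r ^ l * (inverse (fact n) * (?r * norm z) ^ n))"
    by (intro summable_mult summable_exp)
  have "norm (kcoef a j (n + l) / fact n * z ^ n) \<le> ?r ^ l * (inverse (fact n) * (?r * norm z) ^ n)" for n
  proof -
    have "norm (kcoef a j (n + l) / fact n * z ^ n) = norm (kcoef a j (n + l)) * (norm z ^ n / fact n)"
      by (simp add: norm_mult norm_divide norm_power)
    also have "\<dots> \<le> ?r ^ (n + l) * (norm z ^ n / fact n)"
      by (intro mult_right_mono kcoef_bound) auto
    also have "\<dots> = ?r ^ l * (inverse (fact n) * (?r * norm z) ^ n)"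
      by (simp add: power_add power_mult_distrib divide_inverse)
    finally show ?thesis .
  qed
  then show "\<exists>N. \<forall>n\<ge>N. norm (kcoef a j (n + l) / fact n * z ^ n) \<le> ?r ^ l * (inverse (fact n) * (?r * norm z) ^ n)"
    by blast
qed

lemma ksol_at_0: "ksol a j l 0 = kcoef a j l"
  using suminf_finite[of "{0}" "\<lambda>n. kcoef a j (n + l) / fact n * 0 ^ n"]
  by (simp add: ksol_def)

lemma ksol_deriv: "(ksol a j l has_field_derivative ksol a j (Suc l) z) (at z)"
proof -
  have "((\<lambda>z. \<Sum>n. kcoef a j (n + l) / fact n * z ^ n) has_field_derivative
      (\<Sum>n. diffs (\<lambda>n. kcoef a j (n + l) / fact n) n * z ^ n)) (at z)"
    by (rule termdiffs_strong_converges_everywhere) (rule ksol_summable)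
  moreover have "diffs (\<lambda>n. kcoef a j (n + l) / fact n) = (\<lambda>n. kcoef a j (n + Suc l) / fact n)"
    by (auto simp: diffs_def fact_Suc divide_simps simp del: of_nat_Suc)
  ultimately show ?thesis
    by (simp add: ksol_def[abs_def])
qed

lemma ksol_recurrence: "ksol a (Suc j) (Suc (Suc l)) z = a * ksol a (Suc j) l z + ksol a j l z"
proof -
  have "(\<lambda>n. a * (kcoef a (Suc j) (n + l) / fact n * z ^ n) + kcoef a j (n + l) / fact n * z ^ n)
      sums (a * ksol a (Suc j) l z + ksol a j l z)"
    unfolding ksol_def by (intro sums_add sums_mult summable_sums ksol_summable)
  moreover have "(\<lambda>n. a * (kcoef a (Suc j) (n + l) / fact n * z ^ n) + kcoef a j (n + l) / fact n * z ^ n)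
      = (\<lambda>n. kcoef a (Suc j) (n + Suc (Suc l)) / fact n * z ^ n)"
    by (auto simp: field_simps)
  ultimately show ?thesis
    by (simp add: ksol_def sums_iff)
qed

lemma ksol_0 [simp]: "ksol a 0 l z = 0"
  by (simp add: ksol_def)

text \<open>\<open>K\<^sub>j\<close> is odd, so the parity of its derivative of order \<open>l\<close> is that of \<open>l + 1\<close>. The skewness of
the form \<open>pairing\<close> below rests on this.\<close>

lemma ksol_minus: "ksol a j l (- z) = (-1) ^ Suc l * ksol a j l z"
proof -
  have "kcoef a j (n + l) / fact n * (- z) ^ n = (-1) ^ Suc l * (kcoef a j (n + l) / fact n * z ^ n)" for n
    by (cases "even (n + l)"; cases "even n") (auto simp: kcoef_even)
  then have "ksol a j l (- z) = (\<Sum>n. (-1) ^ Suc l * (kcoef a j (n + l) / fact n * z ^ n))"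
    unfolding ksol_def by (simp only:)
  also have "\<dots> = (-1) ^ Suc l * ksol a j l z"
    unfolding ksol_def by (rule suminf_mult[OF ksol_summable])
  finally show ?thesis .
qed

context centred_interval
begin

text \<open>The argument \<open>s\<close> counts derivatives: \<open>kcomb a j n s w\<close> is the derivative of order \<open>s\<close> of the
combination \<open>\<Sum>l<n. K\<^sub>j\<^bsup>(l)\<^esup> w\<^sub>l\<close>.\<close>

definition kcomb :: "complex \<Rightarrow> nat \<Rightarrow> nat \<Rightarrow> nat \<Rightarrow> (nat \<Rightarrow> complex^'m) \<Rightarrow> real \<Rightarrow> complex^'m"
  where "kcomb a j n s w = cutoff T (\<lambda>t. \<Sum>l<n. ksol a j (l + s) (of_real t) *s w l)"

lemma kcomb_C1fun: "kcomb a j n s w \<in> C1fun T" "dfun T (kcomb a j n s w) = kcomb a j n (Suc s) w"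
proof -
  have der: "((\<lambda>t. ksol a j (l + s) (of_real t)) has_vector_derivative ksol a j (l + Suc s) (of_real t)) (at t)" for l t s
    using has_vector_derivative_real_field[OF ksol_deriv[of a j "l + s"]] by simp
  have 1: "((\<lambda>t. \<Sum>l<n. ksol a j (l + s) (of_real t) *s w l) has_vector_derivative
      (\<Sum>l<n. ksol a j (l + Suc s) (of_real t) *s w l)) (at t)" for t s
    using vsmult_has_vector_derivative[OF der has_vector_derivative_const]
    by (intro has_vector_derivative_sum) simp
  have 2: "continuous_on UNIV (\<lambda>t. \<Sum>l<n. ksol a j (l + Suc s) (of_real t) *s w l)"
    using has_vector_derivative_continuous[OF 1[of "Suc s"]] continuous_at_imp_continuous_on by blast
  show "kcomb a j n s w \<in> C1fun T" "dfun T (kcomb a j n s w) = kcomb a j n (Suc s) w"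
    unfolding kcomb_def by (rule dfun_cutoff[OF 1 2])+
qed

lemma kcomb_0: "kcomb a 0 n s w = 0"
  by (auto simp: kcomb_def cutoff_def fun_eq_iff)

lemma kcomb_add: "kcomb a j n s (\<lambda>l. v l + w l) = kcomb a j n s v + kcomb a j n s w"
  by (auto simp: kcomb_def cutoff_def fun_eq_iff vector_add_ldistrib sum.distrib)

lemma kcomb_cscale: "kcomb a j n s (\<lambda>l. c *s w l) = cscale c (kcomb a j n s w)"
  by (auto simp: kcomb_def cutoff_def cscale_def fun_eq_iff vec.scale_sum_right vector_smult_assoc mult.commute)

lemma kcomb_recurrence:
  "kcomb a (Suc j) n (Suc (Suc s)) w - cscale a (kcomb a (Suc j) n s w) = kcomb a j n s w"
  by (auto simp: kcomb_def cutoff_def cscale_def fun_eq_iff ksol_recurrence vector_sadd_rdistrib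
      sum.distrib vec.scale_sum_right vector_smult_assoc)

text \<open>This turns out to be the whole solution space of \<open>(D\<^sup>2 - a)\<^sup>j \<phi> = 0\<close>; see \<open>sqshift_iter_kcomb\<close> and
\<open>sqshift_iter_solution\<close>.\<close>

definition ksolset :: "complex \<Rightarrow> nat \<Rightarrow> (real \<Rightarrow> complex^'m) set"
  where "ksolset a j = range (kcomb a j (2 * j) 0)"

lemma kcomb_extend:
  assumes "n \<le> 2 * j"
  shows "kcomb a j n 0 w \<in> ksolset a j"
proof -
  have "(\<Sum>l<n. ksol a j (l + 0) (of_real t) *s w l)
      = (\<Sum>l<2 * j. ksol a j (l + 0) (of_real t) *s (if l < n then w l else 0))" for t
    using assms by (intro sum.mono_neutral_cong_left) auto
  then have "kcomb a j n 0 w = kcomb a j (2 * j) 0 (\<lambda>l. if l < n then w l else 0)"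
    unfolding kcomb_def by metis
  then show ?thesis by (auto simp: ksolset_def)
qed

lemma subspace_ksolset: "cfun.subspace (ksolset a j)"
proof (rule cfun.subspaceI)
  have "0 = kcomb a j (2 * j) 0 (\<lambda>l. 0)"
    by (auto simp: kcomb_def cutoff_def)
  then show "0 \<in> ksolset a j" unfolding ksolset_def by blast
qed (auto simp: ksolset_def simp flip: kcomb_add kcomb_cscale)

text \<open>\<open>K\<^sub>j\<^bsup>(l)\<^esup> = K\<^sub>j\<^sub>+\<^sub>1\<^bsup>(l+2)\<^esup> - a K\<^sub>j\<^sub>+\<^sub>1\<^bsup>(l)\<^esup>\<close>, and both orders on the right stay below \<open>2(j + 1)\<close>.\<close>

lemma ksolset_mono: "ksolset a j \<subseteq> ksolset a (Suc j)"
proof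
  fix \<phi> :: "real \<Rightarrow> complex^'m"
  assume "\<phi> \<in> ksolset a j"
  then obtain w where w: "\<phi> = kcomb a j (2 * j) 0 w" by (auto simp: ksolset_def)
  \<comment> \<open>two derivatives of the functions amount to a shift of the coefficients by two\<close>
  have range: "2 * Suc j = Suc (Suc (2 * j))" by simp
  have "(\<Sum>l<2 * Suc j. ksol a (Suc j) (l + 0) z *s (if l < 2 then 0 else w (l - 2)))
      = (\<Sum>l<2 * j. ksol a (Suc j) (l + Suc (Suc 0)) z *s w l)" for z
    unfolding range sum.lessThan_Suc_shift by simp
  then have "kcomb a (Suc j) (2 * j) (Suc (Suc 0)) w
      = kcomb a (Suc j) (2 * Suc j) 0 (\<lambda>l. if l < 2 then 0 else w (l - 2))"
    unfolding kcomb_def by metis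
  then have "kcomb a (Suc j) (2 * j) (Suc (Suc 0)) w \<in> ksolset a (Suc j)"
    unfolding ksolset_def by blast
  moreover have "kcomb a (Suc j) (2 * j) 0 w \<in> ksolset a (Suc j)"
    by (rule kcomb_extend) simp
  ultimately show "\<phi> \<in> ksolset a (Suc j)"
    unfolding w kcomb_recurrence[of a j, symmetric]
    by (intro cfun.subspace_diff cfun.subspace_scale subspace_ksolset)
qed

lemma ksolset_1_subset: "ksolset a (Suc 0) \<subseteq> ksolset a (Suc j)"
  by (induction j) (use ksolset_mono in blast)+

text \<open>All derivatives vanish at \<open>0\<close>, which is a triangular system for the coefficients: since
\<open>K\<^sub>j\<close> has its first nonzero derivative at order \<open>2j - 1\<close>, the derivative of order \<open>s\<close> involves only the
\<open>w\<^sub>l\<close> with \<open>l \<ge> 2j - 1 - s\<close>.\<close>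

lemma kcomb_eq_0_imp:
  assumes "kcomb a j (2 * j) 0 w = 0" "l < 2 * j"
  shows "w l = 0"
proof (cases j)
  case (Suc i)
  have "kcomb a j (2 * j) s w = 0" for s
    by (induction s) (use assms(1) kcomb_C1fun(2) C1fun_0(2) in metis)+
  then have "kcomb a j (2 * j) s w 0 = 0" for s by simp
  then have s: "(\<Sum>l<2 * j. kcoef a j (l + s) *s w l) = 0" for s
    using T_pos by (simp add: kcomb_def cutoff_def ksol_at_0)
  have "s < 2 * j \<Longrightarrow> w (2 * j - 1 - s) = 0" for s
  proof (induction s rule: less_induct)
    case (less s)
    let ?l = "2 * j - 1 - s"
    have "kcoef a j (l + s) *s w l = 0" if "l < 2 * j" "l \<noteq> ?l" for l
    proof (cases "l < ?l")
      case True
      then show ?thesis by (simp add: kcoef_low)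
    next
      case False
      then have "l = 2 * j - 1 - (2 * j - 1 - l)" "2 * j - 1 - l < s" using that less.prems by auto
      then show ?thesis using less.IH[of "2 * j - 1 - l"] less.prems by simp
    qed
    then have "(\<Sum>l<2 * j. kcoef a j (l + s) *s w l) = (\<Sum>l\<in>{?l}. kcoef a j (l + s) *s w l)"
      using less.prems by (intro sum.mono_neutral_right) auto
    also have "\<dots> = w ?l"
      using less.prems kcoef_lead[of a i] by (simp add: Suc)
    finally show ?case using s by simp
  qed
  from this[of "2 * j - 1 - l"] assms(2) show ?thesis by simp
qed (use assms in simp)

lemma ksolset_finite_dim: "\<exists>S. finite S \<and> ksolset a j \<subseteq> cfun.span (S :: (real \<Rightarrow> complex^'m) set)"
proof -
  define e where "e = (\<lambda>(l, b::'m). cutoff T (\<lambda>t. ksol a j l (of_real t) *s axis b 1))"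
  define S where "S = e ` ({..<2 * j} \<times> UNIV)"
  have "kcomb a j n 0 w \<in> cfun.span S" if "n \<le> 2 * j" for n and w :: "nat \<Rightarrow> complex^'m"
    using that
  proof (induction n)
    case 0
    have "kcomb a j 0 0 w = 0" by (auto simp: kcomb_def cutoff_def)
    then show ?case by (simp only: cfun.span_zero)
  next
    case (Suc n)
    have "(\<Sum>b\<in>B. cscale (w n $ b) (e (n, b))) t
        = cutoff T (\<lambda>t. ksol a j n (of_real t) *s (\<Sum>b\<in>B. (w n $ b) *s axis b 1)) t" 
      if "finite B" for B t
      using that
      by (induction B) (auto simp: e_def cutoff_def cscale_def vector_add_ldistrib vector_smult_assoc mult.commute)
    then have "kcomb a j (Suc n) 0 w = kcomb a j n 0 w + (\<Sum>b\<in>UNIV. cscale (w n $ b) (e (n, b)))"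
      by (auto simp: kcomb_def cutoff_def fun_eq_iff basis_expansion)
    moreover have "e (n, b) \<in> S" for b using Suc.prems(1) by (auto simp: S_def)
    moreover have "kcomb a j n 0 w \<in> cfun.span S" using Suc by simp
    ultimately show ?case
      by (metis (no_types, lifting) cfun.span_add cfun.span_sum cfun.span_scale cfun.span_base)
  qed
  then have "ksolset a j \<subseteq> cfun.span S" by (auto simp: ksolset_def)
  moreover have "finite S" by (simp add: S_def)
  ultimately show ?thesis by blast
qed

definition smooth :: "(real \<Rightarrow> complex^'m) set"
  where "smooth = {\<phi>. \<forall>k. (dfun T ^^ k) \<phi> \<in> C1fun T}"

lemma smoothD:
  assumes "\<phi> \<in> smooth"
  shows "\<phi> \<in> C1fun T" "dfun T \<phi> \<in> smooth"
proof -
  show "\<phi> \<in> C1fun T" using assms[unfolded smooth_def] by (auto dest!: spec[of _ 0])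
  have "(dfun T ^^ k) (dfun T \<phi>) \<in> C1fun T" for k
    using assms[unfolded smooth_def] by (auto simp: funpow_swap1 dest!: spec[of _ "Suc k"])
  then show "dfun T \<phi> \<in> smooth" by (simp add: smooth_def)
qed

lemma dfun_iter_add:
  assumes "\<phi> \<in> smooth" "\<psi> \<in> smooth"
  shows "(dfun T ^^ k) (\<phi> + \<psi>) = (dfun T ^^ k) \<phi> + (dfun T ^^ k) \<psi>"
  using assms by (induction k) (auto simp: smooth_def C1fun_add)

lemma dfun_iter_cscale:
  assumes "\<phi> \<in> smooth"
  shows "(dfun T ^^ k) (cscale c \<phi>) = cscale c ((dfun T ^^ k) \<phi>)"
  using assms by (induction k) (auto simp: smooth_def C1fun_cscale)

lemma subspace_smooth: "cfun.subspace smooth"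
proof (rule cfun.subspaceI)
  have iter0: "(dfun T ^^ k) 0 = (0 :: real \<Rightarrow> complex^'m)" for k
    by (induction k) (simp_all only: funpow.simps comp_apply id_apply C1fun_0(2))
  show "(0 :: real \<Rightarrow> complex^'m) \<in> smooth"
    unfolding smooth_def by (intro CollectI allI, subst iter0) (rule C1fun_0(1))
  show "x + y \<in> smooth" if "x \<in> smooth" "y \<in> smooth" for x y :: "real \<Rightarrow> complex^'m"
    using that unfolding smooth_def[where 'm = 'm, symmetric]
    by (subst smooth_def) (auto simp: dfun_iter_add, auto simp: smooth_def C1fun_add)
  show "cscale c x \<in> smooth" if "x \<in> smooth" for c and x :: "real \<Rightarrow> complex^'m"
    using that by (subst smooth_def) (auto simp: dfun_iter_cscale, auto simp: smooth_def C1fun_cscale)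
qed

text \<open>Factor \<open>D\<^sup>2 - a\<close> as \<open>(D - r)(D + r)\<close> and apply the uniqueness for first-order equations twice.\<close>

lemma second_order_uniqueness:
  assumes "p \<in> C1fun T" "dfun T p \<in> C1fun T" and eq: "dfun T (dfun T p) = cscale a p"
    and "p 0 = 0" "dfun T p 0 = 0"
  shows "p = 0"
proof -
  define r where "r = csqrt a"
  have a: "a = r * r" using power2_csqrt[of a] by (simp add: r_def power2_eq_square)
  define y where "y = dfun T p + cscale r p"
  have y: "y \<in> C1fun T" unfolding y_def using assms by (intro C1fun_add C1fun_cscale)
  have "dfun T y = cscale r y"
    using assms unfolding y_def
    by (simp add: C1fun_add C1fun_cscale a cfun.scale_right_distrib add.commute)
  then have "y = expfun r (y 0)" using first_order_solution[OF y] by simp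
  moreover have "y 0 = 0" using assms by (simp add: y_def cscale_def)
  ultimately have "y = 0" by (simp add: expfun_def cutoff_def fun_eq_iff)
  then have "dfun T p = cscale (- r) p"
    unfolding y_def by (simp add: cfun.scale_minus_left eq_neg_iff_add_eq_0)
  then have "p = expfun (- r) (p 0)" using first_order_solution[OF assms(1)] by simp
  then show ?thesis using assms by (simp add: expfun_def cutoff_def fun_eq_iff)
qed

definition sqshift :: "complex \<Rightarrow> (real \<Rightarrow> complex^'m) \<Rightarrow> (real \<Rightarrow> complex^'m)"
  where "sqshift a \<phi> = dfun T (dfun T \<phi>) - cscale a \<phi>"

lemma sqshift_smooth: "\<phi> \<in> smooth \<Longrightarrow> sqshift a \<phi> \<in> smooth"
  unfolding sqshift_def
  by (intro cfun.subspace_diff cfun.subspace_scale subspace_smooth smoothD)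

lemma sqshift_kcomb: "sqshift a (kcomb a (Suc j) n s w) = kcomb a j n s w"
  by (simp add: sqshift_def kcomb_C1fun kcomb_recurrence)

lemma kcomb_smooth: "kcomb a j n s w \<in> smooth"
proof -
  have "(dfun T ^^ k) (kcomb a j n s w) = kcomb a j n (s + k) w" for k
    by (induction k) (auto simp: kcomb_C1fun)
  then show ?thesis by (simp add: smooth_def kcomb_C1fun)
qed

lemma sqshift_iter_kcomb: "(sqshift a ^^ j) (kcomb a j n s w) = 0"
  by (induction j) (simp_all add: funpow_swap1 sqshift_kcomb kcomb_0)

text \<open>Induction on \<open>j\<close>. If \<open>(D\<^sup>2 - a) \<phi>\<close> is a combination of derivatives of \<open>K\<^sub>j\<close>, the same combination for
\<open>K\<^sub>j\<^sub>+\<^sub>1\<close> is a particular solution, and the remainder solves the homogeneous second-order equation,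
whose solutions are spanned by \<open>K\<^sub>1\<close> and its derivative.\<close>

lemma sqshift_iter_solution:
  assumes "\<phi> \<in> smooth" "(sqshift a ^^ j) \<phi> = 0"
  shows "\<phi> \<in> ksolset a j"
  using assms
proof (induction j arbitrary: \<phi>)
  case 0
  then have "\<phi> = 0" by (simp only: funpow.simps id_apply)
  then show ?case by (simp only: cfun.subspace_0[OF subspace_ksolset])
next
  case (Suc j)
  have "sqshift a \<phi> \<in> ksolset a j"
    using Suc.IH[OF sqshift_smooth[OF Suc.prems(1)]] Suc.prems(2) by (simp add: funpow_swap1)
    then obtain w where w: "sqshift a \<phi> = kcomb a j (2 * j) 0 w" by (auto simp: ksolset_def)
    define g where "g = kcomb a (Suc j) (2 * j) 0 w"
    define p where "p = \<phi> - g"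
    define v where "v = (\<lambda>l::nat. if l = 0 then dfun T p 0 else p 0)"
    \<comment> \<open>the solution of the homogeneous equation with the initial values of \<open>p\<close>, as \<open>K\<^sub>1\<close> has initial values \<open>0, 1\<close> and \<open>K\<^sub>1'\<close> has \<open>1, 0\<close>\<close>
    define h where "h = kcomb a (Suc 0) 2 0 v"
    have g: "g \<in> smooth" "g \<in> ksolset a (Suc j)"
      unfolding g_def by (rule kcomb_smooth, rule kcomb_extend) simp
    have p: "p \<in> smooth" and h: "h \<in> smooth"
      unfolding p_def h_def using g Suc.prems(1)
      by (auto intro!: cfun.subspace_diff subspace_smooth kcomb_smooth)
    have "dfun T (dfun T p) = dfun T (dfun T \<phi>) - dfun T (dfun T g)"
      unfolding p_def using g(1) Suc.prems(1) by (simp add: C1fun_diff smoothD)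
    moreover have "sqshift a g = sqshift a \<phi>"
      unfolding w g_def by (rule sqshift_kcomb)
    then have "dfun T (dfun T \<phi>) - dfun T (dfun T g) = cscale a \<phi> - cscale a g"
      by (simp add: sqshift_def algebra_simps)
    ultimately have pp: "dfun T (dfun T p) = cscale a p"
      by (simp add: p_def cfun.scale_right_diff_distrib)
    have hh: "dfun T (dfun T h) = cscale a h"
    proof -
      have "sqshift a h = kcomb a 0 2 0 v" unfolding h_def by (rule sqshift_kcomb)
      also have "\<dots> = 0" by (rule kcomb_0)
      finally show ?thesis by (simp add: sqshift_def)
    qed
    have "p - h = 0"
    proof (rule second_order_uniqueness)
      show "p - h \<in> C1fun T" "dfun T (p - h) \<in> C1fun T"
        using p h by (simp_all add: C1fun_diff smoothD)
      show "dfun T (dfun T (p - h)) = cscale a (p - h)"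
        using p h by (simp add: C1fun_diff smoothD pp hh cfun.scale_right_diff_distrib)
      have h0: "h 0 = p 0" "dfun T h 0 = dfun T p 0"
        unfolding h_def kcomb_C1fun(2) 
        by (simp_all add: kcomb_def cutoff_def T_pos less_imp_le ksol_at_0 numeral_2_eq_2 v_def)
      show "(p - h) 0 = 0" "dfun T (p - h) 0 = 0"
        using p h by (simp_all add: C1fun_diff smoothD h0)
    qed
    moreover have "h \<in> ksolset a (Suc 0)"
      unfolding h_def by (rule kcomb_extend) simp
    ultimately have "p \<in> ksolset a (Suc j)" using ksolset_1_subset by auto
    moreover have "\<phi> = p + g" by (simp add: p_def)
    ultimately show ?case
      using g(2) cfun.subspace_add[OF subspace_ksolset] by blast
qed

end

section \<open>The symplectic form and the characteristic matrix\<close>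

text \<open>The bilinear pairing, without conjugation: the adjoint of a matrix must be its transpose.\<close>

definition cdot :: "complex^'m \<Rightarrow> complex^'m \<Rightarrow> complex"
  where "cdot v w = (\<Sum>i\<in>UNIV. v $ i * w $ i)"

lemma cdot_matrix: "cdot v (A *v w) = cdot w (transpose A *v v)"
proof -
  have "cdot v (A *v w) = (\<Sum>i\<in>UNIV. \<Sum>j\<in>UNIV. v $ i * (A $ i $ j * w $ j))"
    by (simp add: cdot_def matrix_vector_mult_def sum_distrib_left)
  also have "\<dots> = (\<Sum>j\<in>UNIV. \<Sum>i\<in>UNIV. v $ i * (A $ i $ j * w $ j))"
    by (rule sum.swap)
  also have "\<dots> = cdot w (transpose A *v v)"
    by (simp add: cdot_def matrix_vector_mult_def sum_distrib_left transpose_def mult_ac)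
  finally show ?thesis .
qed

lemma symplJ_nth: "symplJ $ i $ j = (case (i, j) of
      (Inl a, Inr b) \<Rightarrow> (if a = b then 1 else 0)
    | (Inr a, Inl b) \<Rightarrow> (if a = b then - 1 else 0)
    | _ \<Rightarrow> 0)"
  by (simp add: symplJ_def)

lemma transpose_symplJ: "transpose symplJ = - symplJ"
  by (auto simp: vec_eq_iff transpose_def symplJ_nth split: sum.splits)

lemma symplJ_squared: "symplJ ** symplJ = (- mat 1 :: real^('n::finite+'n)^('n+'n))"
proof -
  have sum_UNIV: "(\<Sum>k\<in>UNIV. f k) = (\<Sum>a\<in>UNIV. f (Inl a)) + (\<Sum>b\<in>UNIV. f (Inr b))"
    for f :: "'n + 'n \<Rightarrow> real"
    by (simp add: UNIV_Plus_UNIV[symmetric] sum.Plus del: UNIV_Plus_UNIV)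
  have "(symplJ ** symplJ) $ i $ j = (- mat 1 :: real^('n+'n)^('n+'n)) $ i $ j" for i j
    by (cases i; cases j) (auto simp: matrix_matrix_mult_def symplJ_nth sum_UNIV mat_def
        if_distrib[of "\<lambda>x. x * _"] if_distrib[of "\<lambda>x. _ * x"] sum.If_cases cong: if_cong)
  then show ?thesis by (simp add: vec_eq_iff)
qed

text \<open>The symplectic form of \<open>J\<close>, extended to a complex bilinear form.\<close>

definition omega :: "complex^('n::finite+'n) \<Rightarrow> complex^('n+'n) \<Rightarrow> complex"
  where "omega v w = cdot v (cmat symplJ *v w)"

lemma omega_linear:
  "omega (u + v) w = omega u w + omega v w" "omega (c *s v) w = c * omega v w"
  "omega v (x + w) = omega v x + omega v w" "omega v (c *s w) = c * omega v w"
  "omega 0 w = 0" "omega v 0 = 0"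
  by (simp_all add: omega_def cdot_def algebra_simps matrix_vector_right_distrib sum.distrib
      sum_distrib_left vec.linear_scale[OF matrix_vector_mul_linear_gen])

lemma omega_sum: "omega v (\<Sum>i\<in>S. f i) = (\<Sum>i\<in>S. omega v (f i))"
  by (induction S rule: infinite_finite_induct) (simp_all add: omega_linear)

lemma cmat_minus: "cmat (- A) = - cmat A" and cmat_mult: "cmat (A ** B) = cmat A ** cmat B"
  and cmat_transpose: "cmat (transpose A) = transpose (cmat A)" and cmat_1: "cmat (mat 1) = mat 1"
  by (simp_all add: cmat_def vec_eq_iff matrix_matrix_mult_def transpose_def mat_def)

lemma omega_skew: "omega w v = - omega v w"
proof -
  have "omega w v = cdot v (cmat (transpose symplJ) *v w)"
    unfolding omega_def by (subst cdot_matrix) (simp add: cmat_transpose)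
  also have "\<dots> = - omega v w"
    by (simp add: transpose_symplJ cmat_minus omega_def cdot_def sum_negf vec.linear_neg
        matrix_vector_mult_def)
  finally show ?thesis .
qed

lemma cmat_symplJ_squared: "cmat symplJ ** cmat symplJ = (- mat 1 :: complex^('n::finite+'n)^('n+'n))"
  by (simp add: symplJ_squared cmat_minus cmat_1 flip: cmat_mult)

lemma omega_nondegenerate:
  fixes w :: "complex^('n::finite+'n)"
  assumes "\<And>v. omega v w = 0"
  shows "w = 0"
proof -
  have "(cmat symplJ *v w) $ i = 0" for i
    using assms[of "axis i 1"]
    by (simp add: omega_def cdot_def axis_def if_distrib[of "\<lambda>x. x * _"] cong: if_cong)
  then have "cmat symplJ *v w = 0"
    by (simp add: vec_eq_iff)
  then have "(cmat symplJ ** cmat symplJ) *v w = 0"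
    by (simp flip: matrix_vector_mul_assoc)
  then show ?thesis
    by (simp add: cmat_symplJ_squared matrix_vector_mult_def mat_def vec_eq_iff sum_negf
      if_distrib[of "\<lambda>x. x * _"] cong: if_cong)
qed

locale hamiltonian_delay =
  fixes K :: nat and \<tau> :: "nat \<Rightarrow> real" and H :: "int \<Rightarrow> real^('n::finite+'n)^('n+'n)"
  assumes K_pos: "K \<ge> 1" and tau_pos: "0 < \<tau> 1" and tau_mono: "strict_mono_on {1..K} \<tau>"
    and ham_0: "transpose (symplJ ** H 0) = symplJ ** H 0"
    and ham: "\<And>k. k \<in> {1..K} \<Longrightarrow> transpose (symplJ ** H (- int k)) = symplJ ** H (int k)"
begin

lemma tau_range: "k \<in> {1..K} \<Longrightarrow> 0 < \<tau> k \<and> \<tau> k \<le> \<tau> K"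
  using tau_pos K_pos strict_mono_onD[OF tau_mono, of 1 k] strict_mono_onD[OF tau_mono, of k K]
  by (cases "k = 1"; cases "k = K") auto

sublocale centred_interval "\<tau> K"
  by unfold_locales (use tau_range[of K] K_pos in auto)

abbreviation D :: "(real \<Rightarrow> complex^('n+'n)) \<Rightarrow> (real \<Rightarrow> complex^('n+'n))"
  where "D \<equiv> dfun (\<tau> K)"

text \<open>The right-hand side of the boundary condition at \<open>0\<close>; the defect measures the failure of the condition.\<close>

definition nonlocal :: "(real \<Rightarrow> complex^('n+'n)) \<Rightarrow> complex^('n+'n)"
  where "nonlocal \<phi> = cmat (H 0) *v \<phi> 0
    + (\<Sum>k=1..K. cmat (H (- int k)) *v \<phi> (- \<tau> k) + cmat (H (int k)) *v \<phi> (\<tau> k))"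

definition defect :: "(real \<Rightarrow> complex^('n+'n)) \<Rightarrow> complex^('n+'n)"
  where "defect \<phi> = D \<phi> 0 - nonlocal \<phi>"

lemma nonlocal_add: "nonlocal (\<phi> + \<psi>) = nonlocal \<phi> + nonlocal \<psi>"
  by (simp add: nonlocal_def matrix_vector_right_distrib sum.distrib)

lemma nonlocal_cscale: "nonlocal (cscale c \<phi>) = c *s nonlocal \<phi>"
  by (simp add: nonlocal_def cscale_def vec.linear_scale[OF matrix_vector_mul_linear_gen]
      vec.scale_sum_right vector_add_ldistrib)

lemma nonlocal_0: "nonlocal 0 = 0"
  by (simp add: nonlocal_def)

lemma defect_add:
  "\<phi> \<in> C1fun (\<tau> K) \<Longrightarrow> \<psi> \<in> C1fun (\<tau> K) \<Longrightarrow> defect (\<phi> + \<psi>) = defect \<phi> + defect \<psi>"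
  unfolding defect_def nonlocal_add by (simp only: C1fun_add plus_fun_apply add_diff_add)

lemma defect_cscale: "\<phi> \<in> C1fun (\<tau> K) \<Longrightarrow> defect (cscale c \<phi>) = c *s defect \<phi>"
  unfolding defect_def nonlocal_cscale by (simp only: C1fun_cscale) (simp only: cscale_def vector_ssub_ldistrib)

lemma defect_0: "defect 0 = 0"
  unfolding defect_def nonlocal_0 by (simp only: C1fun_0 zero_fun_apply diff_self)

lemma defect_diff:
  assumes "\<phi> \<in> C1fun (\<tau> K)" "\<psi> \<in> C1fun (\<tau> K)"
  shows "defect (\<phi> - \<psi>) = defect \<phi> - defect \<psi>"
  using defect_add[OF C1fun_diff(1)[OF assms] assms(2)] by simp

lemma domH_iff: "\<phi> \<in> domH K \<tau> H \<longleftrightarrow> \<phi> \<in> C1fun (\<tau> K) \<and> defect \<phi> = 0"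
  by (auto simp: domH_def Hcond_def defect_def nonlocal_def)

lemma domR_iff: "\<phi> \<in> domR K \<tau> H \<longleftrightarrow> \<phi> \<in> domH K \<tau> H \<and> D \<phi> \<in> domH K \<tau> H"
  by (auto simp: domH_def domR_def)

lemma subspace_domH: "cfun.subspace (domH K \<tau> H)"
  by (rule cfun.subspaceI)
    (simp_all add: domH_iff C1fun_add C1fun_cscale C1fun_0 defect_add defect_cscale defect_0)

text \<open>The defect of the function \<open>f(t) v\<close> is \<open>symbol d f v\<close> for \<open>d = f'(0)\<close>. Taking \<open>d\<close> as a separate argument
keeps derivatives out of the matrix algebra. For \<open>f(t) = exp (\<nu>t)\<close> this is the characteristic matrix.\<close>

definition symbol :: "complex \<Rightarrow> (real \<Rightarrow> complex) \<Rightarrow> complex^('n+'n)^('n+'n)"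
  where "symbol d f = (\<chi> i j. d * (if i = j then 1 else 0) - f 0 * of_real (H 0 $ i $ j)
    - (\<Sum>k=1..K. f (- \<tau> k) * of_real (H (- int k) $ i $ j) + f (\<tau> k) * of_real (H (int k) $ i $ j)))"

lemma symbol_apply: "d *s v - nonlocal (cutoff (\<tau> K) (\<lambda>t. f t *s v)) = symbol d f *v v"
proof -
  have c: "cutoff (\<tau> K) (\<lambda>t. f t *s v) t = f t *s v" if "t \<in> {- \<tau> K..\<tau> K}" for t
    using that by (simp add: cutoff_def)
  have c0: "cutoff (\<tau> K) (\<lambda>t. f t *s v) 0 = f 0 *s v"
    using T_pos by (intro c) auto
  have ck: "cutoff (\<tau> K) (\<lambda>t. f t *s v) (- \<tau> k) = f (- \<tau> k) *s v"
    "cutoff (\<tau> K) (\<lambda>t. f t *s v) (\<tau> k) = f (\<tau> k) *s v" if "k \<in> {1..K}" for k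
    using tau_range[OF that] by (auto intro!: c)
  have n: "nonlocal (cutoff (\<tau> K) (\<lambda>t. f t *s v)) = cmat (H 0) *v (f 0 *s v)
    + (\<Sum>k=1..K. cmat (H (- int k)) *v (f (- \<tau> k) *s v) + cmat (H (int k)) *v (f (\<tau> k) *s v))"
    unfolding nonlocal_def by (simp add: c0 ck)
  have "(symbol d f *v v) $ i = (d *s v - nonlocal (cutoff (\<tau> K) (\<lambda>t. f t *s v))) $ i" for i
  proof -
    have "(symbol d f *v v) $ i = (\<Sum>j\<in>UNIV. d * (if i = j then v $ j else 0))
        - (\<Sum>j\<in>UNIV. f 0 * of_real (H 0 $ i $ j) * v $ j)
        - (\<Sum>j\<in>UNIV. \<Sum>k=1..K. f (- \<tau> k) * of_real (H (- int k) $ i $ j) * v $ j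
              + f (\<tau> k) * of_real (H (int k) $ i $ j) * v $ j)"
      by (simp add: symbol_def matrix_vector_mult_def left_diff_distrib sum_subtractf
          sum_distrib_right distrib_right if_distrib[of "\<lambda>x. x * _"] if_distrib[of "\<lambda>x. _ * x"]
          cong: if_cong)
    also have "(\<Sum>j\<in>UNIV. \<Sum>k=1..K. f (- \<tau> k) * of_real (H (- int k) $ i $ j) * v $ j
              + f (\<tau> k) * of_real (H (int k) $ i $ j) * v $ j)
       = (\<Sum>k=1..K. \<Sum>j\<in>UNIV. f (- \<tau> k) * of_real (H (- int k) $ i $ j) * v $ j
              + f (\<tau> k) * of_real (H (int k) $ i $ j) * v $ j)"
      by (rule sum.swap)
    finally show ?thesis
      unfolding n
      by (simp add: cmat_def matrix_vector_mult_def sum.distrib mult_ac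
          if_distrib[of "\<lambda>x. _ * x"] cong: if_cong)
  qed
  then show ?thesis by (simp add: vec_eq_iff)
qed

lemma symbol_scale: "symbol (c * d) (\<lambda>t. c * f t) *v v = c *s (symbol d f *v v)"
proof -
  have "cutoff (\<tau> K) (\<lambda>t. (c * f t) *s v) = cscale c (cutoff (\<tau> K) (\<lambda>t. f t *s v))"
    by (auto simp: cutoff_def cscale_def vector_smult_assoc)
  then show ?thesis
    by (simp add: nonlocal_cscale vector_ssub_ldistrib vector_smult_assoc flip: symbol_apply)
qed

text \<open>The only place where the symmetry of the matrices \<open>J H\<^sub>k\<close> is used: transposition exchanges the delays
\<open>\<tau>\<^sub>k\<close> and \<open>-\<tau>\<^sub>k\<close>, and \<open>J\<close> changes its sign.\<close>

lemma transpose_J_symbol: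
  "transpose (cmat symplJ ** symbol d f) = cmat symplJ ** symbol (- d) (\<lambda>t. f (- t))"
proof -
  define h where "h = (\<lambda>k i j. complex_of_real ((symplJ ** H k) $ i $ j))"
  have J: "(cmat symplJ ** symbol d f) $ i $ j = d * of_real (symplJ $ i $ j) - f 0 * h 0 i j
      - (\<Sum>k=1..K. f (- \<tau> k) * h (- int k) i j + f (\<tau> k) * h (int k) i j)" for d f i j
  proof -
    have "(cmat symplJ ** symbol d f) $ i $ j
       = (\<Sum>l\<in>UNIV. d * (if l = j then of_real (symplJ $ i $ l) else 0))
        - (\<Sum>l\<in>UNIV. f 0 * (of_real (symplJ $ i $ l) * of_real (H 0 $ l $ j)))
        - (\<Sum>l\<in>UNIV. \<Sum>k=1..K. f (- \<tau> k) * (of_real (symplJ $ i $ l) * of_real (H (- int k) $ l $ j))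
              + f (\<tau> k) * (of_real (symplJ $ i $ l) * of_real (H (int k) $ l $ j)))"
      by (simp add: symbol_def cmat_def matrix_matrix_mult_def right_diff_distrib sum_subtractf
          sum_distrib_left distrib_left mult_ac if_distrib[of "\<lambda>x. x * _"] if_distrib[of "\<lambda>x. _ * x"]
          cong: if_cong)
    also have "(\<Sum>l\<in>UNIV. \<Sum>k=1..K. f (- \<tau> k) * (of_real (symplJ $ i $ l) * of_real (H (- int k) $ l $ j))
              + f (\<tau> k) * (of_real (symplJ $ i $ l) * of_real (H (int k) $ l $ j)))
       = (\<Sum>k=1..K. \<Sum>l\<in>UNIV. f (- \<tau> k) * (of_real (symplJ $ i $ l) * of_real (H (- int k) $ l $ j))
              + f (\<tau> k) * (of_real (symplJ $ i $ l) * of_real (H (int k) $ l $ j)))"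
      by (rule sum.swap)
    finally show ?thesis
      by (simp add: h_def matrix_matrix_mult_def sum.distrib sum_distrib_left
          if_distrib[of "\<lambda>x. _ * x"] cong: if_cong)
  qed
  have J': "symplJ $ j $ i = - (symplJ :: real^('n+'n)^('n+'n)) $ i $ j" for i j
    using arg_cong[OF transpose_symplJ[where 'a = 'n], of "\<lambda>A. A $ i $ j"]
    by (simp add: transpose_def)
  have h0: "h 0 j i = h 0 i j" for i j
    using arg_cong[OF ham_0, of "\<lambda>A. A $ i $ j"] by (simp add: h_def transpose_def)
  have hk: "h (- int k) j i = h (int k) i j" if "k \<in> {1..K}" for k i j
    using arg_cong[OF ham[OF that], of "\<lambda>A. A $ i $ j"] by (simp add: h_def transpose_def)
  have "(cmat symplJ ** symbol d f) $ j $ i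
      = (cmat symplJ ** symbol (- d) (\<lambda>t. f (- t))) $ i $ j" for i j
  proof -
    have "(\<Sum>k=1..K. f (- \<tau> k) * h (- int k) j i + f (\<tau> k) * h (int k) j i)
        = (\<Sum>k=1..K. f (\<tau> k) * h (- int k) i j + f (- \<tau> k) * h (int k) i j)"
      by (rule sum.cong) (simp_all add: hk add.commute)
    then show ?thesis by (simp add: J J'[of j i] h0[of j i])
  qed
  then show ?thesis by (simp add: vec_eq_iff transpose_def)
qed

lemma omega_symbol: "omega v (symbol d f *v w) = omega w (symbol (- d) (\<lambda>t. f (- t)) *v v)"
  unfolding omega_def matrix_vector_mul_assoc
  by (subst cdot_matrix) (simp add: transpose_J_symbol)

definition charmat :: "complex \<Rightarrow> complex^('n+'n)^('n+'n)"
  where "charmat \<nu> = symbol \<nu> (\<lambda>t. exp (\<nu> * of_real t))"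

lemma defect_expfun: "defect (expfun \<nu> v) = charmat \<nu> *v v"
  unfolding charmat_def symbol_apply[symmetric] defect_def
  by (simp add: expfun_C1fun cscale_def) (simp add: expfun_def)

lemma det_charmat_minus: "det (charmat (- \<nu>)) = det (charmat \<nu>)"
proof -
  let ?J = "cmat symplJ :: complex^('n+'n)^('n+'n)"
  have "transpose (?J ** charmat \<nu>) = ?J ** charmat (- \<nu>)"
    using transpose_J_symbol[of \<nu> "\<lambda>t. exp (\<nu> * of_real t)"] by (simp add: charmat_def)
  then have "det (?J ** charmat \<nu>) = det (?J ** charmat (- \<nu>))"
    by (metis det_transpose)
  then have e: "det ?J * det (charmat \<nu>) = det ?J * det (charmat (- \<nu>))"
    by (simp only: det_mul)
  have "(- ?J) ** ?J = mat 1"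
    using cmat_symplJ_squared[where 'n = 'n]
    by (simp add: vec_eq_iff matrix_matrix_mult_def sum_negf)
  then have "det (- ?J) * det ?J = 1"
    by (metis det_mul det_I)
  then have "det ?J \<noteq> 0" by auto
  then show ?thesis using e by simp
qed

text \<open>An eigenfunction at \<open>\<nu>\<close> has the form \<open>exp (\<nu> t) v\<close>, and its defect is \<open>M(\<nu>) v\<close>.\<close>

lemma eigenvalue_iff_det: "eigenvalue (domH K \<tau> H) (opH K \<tau>) \<nu> \<longleftrightarrow> det (charmat \<nu>) = 0"
proof -
  have "eigenvalue (domH K \<tau> H) (opH K \<tau>) \<nu> \<longleftrightarrow> (\<exists>v. v \<noteq> 0 \<and> charmat \<nu> *v v = 0)"
  proof
    assume "eigenvalue (domH K \<tau> H) (opH K \<tau>) \<nu>"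
    then obtain \<phi> where p: "\<phi> \<in> C1fun (\<tau> K)" "defect \<phi> = 0" "D \<phi> = cscale \<nu> \<phi>" "\<phi> \<noteq> 0"
      by (auto simp: eigenvalue_def eigenfunction_def eigenspace_def domH_iff opH_def)
    have e: "\<phi> = expfun \<nu> (\<phi> 0)" using p by (intro first_order_solution)
    then have "charmat \<nu> *v \<phi> 0 = 0" using p(2) defect_expfun by metis
    moreover have "\<phi> 0 \<noteq> 0"
    proof
      assume "\<phi> 0 = 0"
      then have "\<phi> = 0" by (subst e) (auto simp: expfun_def cutoff_def)
      with p(4) show False by simp
    qed
    ultimately show "\<exists>v. v \<noteq> 0 \<and> charmat \<nu> *v v = 0" by blast
  next
    assume "\<exists>v. v \<noteq> 0 \<and> charmat \<nu> *v v = 0"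
    then obtain v where v: "v \<noteq> 0" "charmat \<nu> *v v = 0" by blast
    have "expfun \<nu> v \<noteq> 0"
      using v(1) expfun_0 zero_fun_apply by metis
    then have "eigenfunction (domH K \<tau> H) (opH K \<tau>) \<nu> (expfun \<nu> v)"
      by (auto simp: eigenfunction_def eigenspace_def domH_iff opH_def expfun_C1fun defect_expfun v)
    then show "eigenvalue (domH K \<tau> H) (opH K \<tau>) \<nu>" by (auto simp: eigenvalue_def)
  qed
  also have "\<dots> \<longleftrightarrow> det (charmat \<nu>) = 0"
    using matrix_left_invertible_ker[of "charmat \<nu>"] invertible_det_nz[of "charmat \<nu>"]
      invertible_left_inverse[of "charmat \<nu>"] by auto
  finally show ?thesis .
qed

lemma eigenvalue_minus:
  "eigenvalue (domH K \<tau> H) (opH K \<tau>) (- \<nu>) \<longleftrightarrow> eigenvalue (domH K \<tau> H) (opH K \<tau>) \<nu>"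
  by (simp add: eigenvalue_iff_det det_charmat_minus)

end

section \<open>Even dimension of the kernels of powers\<close>

context centred_interval
begin

lemma smooth_iter: "\<phi> \<in> smooth \<Longrightarrow> (dfun T ^^ i) \<phi> \<in> smooth"
  by (induction i) (auto intro: smoothD(2))

lemma dfun_iter_sqshift:
  fixes \<phi> :: "real \<Rightarrow> complex^'m"
  assumes "\<phi> \<in> smooth"
  shows "(dfun T ^^ i) (sqshift a \<phi>) = sqshift a ((dfun T ^^ i) \<phi>)"
proof (induction i)
  case (Suc i)
  have "dfun T (sqshift a \<psi>) = sqshift a (dfun T \<psi>)" if "\<psi> \<in> smooth" for \<psi> :: "real \<Rightarrow> complex^'m"
    using that by (simp only: sqshift_def C1fun_diff C1fun_cscale smoothD)
  then show ?case using Suc smooth_iter[OF assms] by (simp only: funpow.simps comp_apply)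
qed (simp only: funpow.simps id_apply)

text \<open>The coefficients of an element of \<open>ksolset a j\<close>. They are determined for \<open>l < 2j\<close> and arbitrary beyond.\<close>

definition coef :: "complex \<Rightarrow> nat \<Rightarrow> (real \<Rightarrow> complex^'m) \<Rightarrow> nat \<Rightarrow> complex^'m"
  where "coef a j f = (SOME w. f = kcomb a j (2 * j) 0 w)"

lemma kcomb_coef: "f \<in> ksolset a j \<Longrightarrow> kcomb a j (2 * j) 0 (coef a j f) = f"
  unfolding ksolset_def coef_def
  by (erule rangeE) (rule someI[of "\<lambda>w. f = kcomb a j (2 * j) 0 w", symmetric])

lemma coef_kcomb:
  assumes "l < 2 * j"
  shows "coef a j (kcomb a j (2 * j) 0 w) l = w l"
proof -
  let ?c = "coef a j (kcomb a j (2 * j) 0 w)"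
  have c: "kcomb a j (2 * j) 0 ?c = kcomb a j (2 * j) 0 w"
    by (rule kcomb_coef) (auto simp: ksolset_def)
  have "kcomb a j (2 * j) 0 (\<lambda>l. ?c l + (-1) *s w l)
      = kcomb a j (2 * j) 0 w + cscale (-1) (kcomb a j (2 * j) 0 w)"
    unfolding kcomb_add kcomb_cscale c ..
  also have "\<dots> = 0" by (simp only: cfun.scale_minus_left cfun.scale_one right_minus)
  finally have "?c l + (-1) *s w l = 0" using assms by (rule kcomb_eq_0_imp)
  then show ?thesis by simp
qed

lemma coef_add:
  assumes "f \<in> ksolset a j" "g \<in> ksolset a j" "l < 2 * j"
  shows "coef a j (f + g) l = coef a j f l + coef a j g l"
  using coef_kcomb[OF assms(3), of a "\<lambda>l. coef a j f l + coef a j g l"] assms(1,2)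
  by (simp only: kcomb_add kcomb_coef)

lemma coef_cscale:
  assumes "f \<in> ksolset a j" "l < 2 * j"
  shows "coef a j (cscale c f) l = c *s coef a j f l"
  using coef_kcomb[OF assms(2), of a "\<lambda>l. c *s coef a j f l"] assms(1)
  by (simp only: kcomb_cscale kcomb_coef)

lemma kcomb_Suc: "kcomb a j (Suc n) s w = kcomb a j n s w + kcomb a j (Suc 0) (n + s) (\<lambda>_. w n)"
  by (auto simp: kcomb_def cutoff_def fun_eq_iff)

end

context hamiltonian_delay
begin

text \<open>The intersection of the domains of all powers of \<open>\<H>\<close>: a space that \<open>\<H>\<close> maps to itself and
that contains all its generalised eigenfunctions.\<close>

definition smooth_dom :: "(real \<Rightarrow> complex^('n+'n)) set"
  where "smooth_dom = {\<phi> \<in> smooth. \<forall>i. defect ((D ^^ i) \<phi>) = 0}"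

lemma smooth_dom_smooth: "\<phi> \<in> smooth_dom \<Longrightarrow> \<phi> \<in> smooth"
  by (simp add: smooth_dom_def)

lemma D_smooth_dom: "\<phi> \<in> smooth_dom \<Longrightarrow> D \<phi> \<in> smooth_dom"
  unfolding smooth_dom_def using smoothD(2)
  by (auto simp: funpow_swap1 dest: spec[of _ "Suc _"])

lemma smooth_dom_domH: "\<phi> \<in> smooth_dom \<Longrightarrow> \<phi> \<in> domH K \<tau> H"
  unfolding smooth_dom_def domH_iff by (auto dest: spec[of _ 0] smoothD(1))

lemma subspace_smooth_dom: "cfun.subspace smooth_dom"
proof (rule cfun.subspaceI)
  have "(D ^^ i) 0 = (0 :: real \<Rightarrow> complex^('n+'n))" for i
    by (induction i) (simp_all only: funpow.simps comp_apply id_apply C1fun_0(2))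
  then show "(0 :: real \<Rightarrow> complex^('n+'n)) \<in> smooth_dom"
    unfolding smooth_dom_def using cfun.subspace_0[OF subspace_smooth] 
    by (simp only: defect_0 mem_Collect_eq simp_thms)
next
  fix x y :: "real \<Rightarrow> complex^('n+'n)"
  assume xy: "x \<in> smooth_dom" "y \<in> smooth_dom"
  then have s: "x \<in> smooth" "y \<in> smooth" by (auto dest: smooth_dom_smooth)
  then have "x + y \<in> smooth" using cfun.subspace_add[OF subspace_smooth] by blast
  moreover have "defect ((D ^^ i) (x + y)) = 0" for i
  proof -
    have "defect ((D ^^ i) (x + y)) = defect ((D ^^ i) x) + defect ((D ^^ i) y)"
      using s by (simp only: dfun_iter_add defect_add smooth_iter smoothD(1))
    then show ?thesis using xy by (simp add: smooth_dom_def)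
  qed
  ultimately show "x + y \<in> smooth_dom" by (simp only: smooth_dom_def mem_Collect_eq simp_thms)
next
  fix c and x :: "real \<Rightarrow> complex^('n+'n)"
  assume x: "x \<in> smooth_dom"
  then have s: "x \<in> smooth" by (rule smooth_dom_smooth)
  then have "cscale c x \<in> smooth" using cfun.subspace_scale[OF subspace_smooth] by blast
  moreover have "defect ((D ^^ i) (cscale c x)) = 0" for i
  proof -
    have "defect ((D ^^ i) (cscale c x)) = c *s defect ((D ^^ i) x)"
      using s by (simp only: dfun_iter_cscale defect_cscale smooth_iter smoothD(1))
    then show ?thesis using x by (simp add: smooth_dom_def)
  qed
  ultimately show "cscale c x \<in> smooth_dom" by (simp only: smooth_dom_def mem_Collect_eq simp_thms)
qed

lemma sqshift_smooth_dom: "\<phi> \<in> smooth_dom \<Longrightarrow> sqshift a \<phi> \<in> smooth_dom"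
  unfolding sqshift_def
  by (intro cfun.subspace_diff cfun.subspace_scale subspace_smooth_dom D_smooth_dom)

lemma defect_iter_sqshift:
  assumes "\<phi> \<in> smooth"
  shows "defect ((D ^^ i) (sqshift a \<phi>)) = defect ((D ^^ Suc (Suc i)) \<phi>) - a *s defect ((D ^^ i) \<phi>)"
proof -
  let ?p = "(D ^^ i) \<phi>"
  have p: "?p \<in> smooth" using assms by (rule smooth_iter)
  then have "D (D ?p) \<in> C1fun (\<tau> K)" "cscale a ?p \<in> C1fun (\<tau> K)" "?p \<in> C1fun (\<tau> K)"
    by (auto intro: smoothD C1fun_cscale)
  then have "defect (sqshift a ?p) = defect (D (D ?p)) - a *s defect ?p"
    unfolding sqshift_def by (simp only: defect_diff defect_cscale)
  then show ?thesis
    using assms by (simp only: dfun_iter_sqshift funpow.simps comp_apply)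
qed

text \<open>The differential equation of order \<open>2j\<close> expresses the defects of the higher derivatives by those of the
first \<open>2j\<close> ones.\<close>

lemma smooth_domI:
  assumes "\<phi> \<in> smooth" "(sqshift a ^^ j) \<phi> = 0" "\<And>i. i < 2 * j \<Longrightarrow> defect ((D ^^ i) \<phi>) = 0"
  shows "\<phi> \<in> smooth_dom"
  using assms
proof (induction j arbitrary: \<phi>)
  case 0
  have "\<phi> = 0" using "0"(2) by (simp only: funpow.simps id_apply)
  then show ?case by (simp only: cfun.subspace_0[OF subspace_smooth_dom])
next
  case (Suc j)
  have "sqshift a \<phi> \<in> smooth_dom"
  proof (rule Suc.IH)
    show "sqshift a \<phi> \<in> smooth" using Suc.prems(1) by (rule sqshift_smooth)
    show "(sqshift a ^^ j) (sqshift a \<phi>) = 0"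
      using Suc.prems(2) by (simp only: funpow.simps funpow_swap1 comp_apply)
    show "defect ((D ^^ i) (sqshift a \<phi>)) = 0" if "i < 2 * j" for i
      using that Suc.prems(3)[of i] Suc.prems(3)[of "Suc (Suc i)"]
      unfolding defect_iter_sqshift[OF Suc.prems(1)] by simp
  qed
  then have step: "defect ((D ^^ Suc (Suc i)) \<phi>) = a *s defect ((D ^^ i) \<phi>)" for i
    using defect_iter_sqshift[OF Suc.prems(1), of i a] by (simp add: smooth_dom_def)
  have "defect ((D ^^ i) \<phi>) = 0 \<and> defect ((D ^^ Suc i) \<phi>) = 0" for i
  proof (induction i)
    case 0
    show ?case using Suc.prems(3)[of 0] Suc.prems(3)[of "Suc 0"] by simp
  next
    case (Suc i)
    then show ?case using step[of i] by simp
  qed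
  then show ?case using Suc.prems(1) by (simp only: smooth_dom_def mem_Collect_eq simp_thms)
qed

definition sq_kernel :: "complex \<Rightarrow> nat \<Rightarrow> (real \<Rightarrow> complex^('n+'n)) set"
  where "sq_kernel a j = {\<phi> \<in> smooth_dom. (sqshift a ^^ j) \<phi> = 0}"

text \<open>The equation \<open>D\<^sup>2 \<phi> = a \<phi> + (D\<^sup>2 - a) \<phi>\<close> passes smoothness and the boundary conditions from
\<open>\<phi>\<close> to its second derivative, and so on to all derivatives.\<close>

lemma smooth_dom_if_sqshift:
  assumes "\<phi> \<in> domR K \<tau> H" "sqshift a \<phi> \<in> smooth_dom"
  shows "\<phi> \<in> smooth_dom"
proof -
  let ?s = "sqshift a \<phi>"
  have s: "(D ^^ k) ?s \<in> C1fun (\<tau> K)" "defect ((D ^^ k) ?s) = 0" for k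
    using assms(2) by (auto simp: smooth_dom_def smooth_def)
  have "(D ^^ k) \<phi> \<in> domH K \<tau> H \<and> (D ^^ Suc k) \<phi> \<in> domH K \<tau> H \<and>
      (D ^^ Suc (Suc k)) \<phi> = cscale a ((D ^^ k) \<phi>) + (D ^^ k) ?s" for k
  proof (induction k)
    case 0
    have "D (D \<phi>) = cscale a \<phi> + ?s" by (simp add: sqshift_def)
    then show ?case using assms(1) by (simp add: domR_iff)
  next
    case (Suc k)
    have ds: "(D ^^ k) ?s \<in> domH K \<tau> H" using s by (simp add: domH_iff)
    have e: "(D ^^ Suc (Suc k)) \<phi> = cscale a ((D ^^ k) \<phi>) + (D ^^ k) ?s" using Suc by blast
    have "(D ^^ Suc (Suc k)) \<phi> \<in> domH K \<tau> H"
      unfolding e using Suc ds by (intro cfun.subspace_add cfun.subspace_scale subspace_domH) auto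
    moreover have "D ((D ^^ Suc (Suc k)) \<phi>) = cscale a (D ((D ^^ k) \<phi>)) + D ((D ^^ k) ?s)"
      unfolding e using Suc s by (simp only: C1fun_add C1fun_cscale domH_iff)
    ultimately show ?case using Suc by (simp only: funpow.simps comp_apply simp_thms)
  qed
  then show ?thesis by (auto simp: smooth_dom_def smooth_def domH_iff)
qed

lemma ker_pow_R:
  assumes "a = \<sigma>\<^sup>2 + \<rho>"
  shows "ker_pow (domR K \<tau> H) (opR K \<tau> \<sigma>) \<rho> j = sq_kernel a j"
proof (induction j)
  case 0
  show ?case
    unfolding sq_kernel_def ker_pow.simps funpow_0
    using cfun.subspace_0[OF subspace_smooth_dom] by blast
next
  case (Suc j)
  have e: "opR K \<tau> \<sigma> \<phi> - cscale \<rho> \<phi> = sqshift a \<phi>" for \<phi>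
    unfolding opR_def sqshift_def assms cfun.scale_left_distrib by (rule diff_diff_eq)
  have "\<phi> \<in> domR K \<tau> H \<and> sqshift a \<phi> \<in> smooth_dom \<longleftrightarrow> \<phi> \<in> smooth_dom" for \<phi>
  proof
    assume "\<phi> \<in> smooth_dom"
    then show "\<phi> \<in> domR K \<tau> H \<and> sqshift a \<phi> \<in> smooth_dom"
      by (simp add: domR_iff smooth_dom_domH D_smooth_dom sqshift_smooth_dom)
  qed (blast intro: smooth_dom_if_sqshift)
  then have "\<phi> \<in> domR K \<tau> H \<and> sqshift a \<phi> \<in> sq_kernel a j \<longleftrightarrow> \<phi> \<in> sq_kernel a (Suc j)" for \<phi>
    unfolding sq_kernel_def funpow_Suc_right by auto
  then show ?case unfolding ker_pow.simps Suc e by blast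
qed

lemma sq_kernel_subset: "sq_kernel a j \<subseteq> ksolset a j"
  unfolding sq_kernel_def using sqshift_iter_solution smooth_dom_smooth by blast

text \<open>\<open>ksymbol a j r\<close> is the matrix through which the nonlocal condition acts on \<open>K\<^sub>j\<^bsup>(r)\<^esup> v\<close>.\<close>

definition ksymbol :: "complex \<Rightarrow> nat \<Rightarrow> nat \<Rightarrow> complex^('n+'n)^('n+'n)"
  where "ksymbol a j r = symbol (kcoef a j (Suc r)) (\<lambda>t. ksol a j r (of_real t))"

lemma defect_kcomb: "defect (kcomb a j n s w) = (\<Sum>l<n. ksymbol a j (l + s) *v w l)"
proof (induction n)
  case 0
  have "kcomb a j 0 s w = 0" by (auto simp: kcomb_def cutoff_def)
  then show ?case by (simp only: defect_0 lessThan_0 sum.empty)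
next
  case (Suc n)
  have one: "defect (kcomb a j (Suc 0) r (\<lambda>_. v)) = ksymbol a j r *v v" for r v
    unfolding defect_def kcomb_C1fun(2) ksymbol_def symbol_apply[symmetric]
    using T_pos by (simp add: kcomb_def ksol_at_0) (simp add: cutoff_def ksol_at_0)
  have "defect (kcomb a j (Suc n) s w)
      = defect (kcomb a j n s w) + defect (kcomb a j (Suc 0) (n + s) (\<lambda>_. w n))"
    by (subst kcomb_Suc) (rule defect_add[OF kcomb_C1fun(1) kcomb_C1fun(1)])
  then show ?case by (simp only: one Suc.IH sum.lessThan_Suc)
qed

text \<open>Oddness of \<open>K\<^sub>j\<close> meets the Hamiltonian symmetry: reflecting the argument only multiplies the symbol by
\<open>(-1)\<^bsup>r+1\<^esup>\<close>.\<close>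

lemma omega_ksymbol:
  "omega v (ksymbol a j r *v w) = (-1) ^ Suc r * omega w (ksymbol a j r *v v)"
proof -
  have d: "- kcoef a j (Suc r) = (-1) ^ Suc r * kcoef a j (Suc r)"
    by (cases "even r") (auto simp: kcoef_even)
  have "symbol (- kcoef a j (Suc r)) (\<lambda>t. ksol a j r (of_real (- t))) *v v
      = (-1) ^ Suc r *s (ksymbol a j r *v v)"
    unfolding d ksymbol_def symbol_scale[symmetric] of_real_minus ksol_minus ..
  then show ?thesis
    unfolding ksymbol_def by (subst omega_symbol) (simp only: omega_linear)
qed

text \<open>With coefficients \<open>v\<close> of \<open>f\<close> and \<open>w\<close> of \<open>g\<close>, and with \<open>p(z) = (z\<^sup>2 - a)\<^sup>j\<close>, this is the sum of the residues of
\<open>v(-z)\<^sup>T J M(z) w(z) / p(z)\<close> at the zeros of \<open>p\<close>, where \<open>v(z)\<close> and \<open>w(z)\<close> are the polynomials with these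
coefficients. The substitution \<open>z \<mapsto> -z\<close> explains why the form is alternating.\<close>

definition pairing where
  "pairing a j f g = (\<Sum>i<2 * j. (-1) ^ i * omega (coef a j f i) (defect ((D ^^ i) g)))"

lemma D_iter_kcomb: "(D ^^ i) (kcomb a j n s w) = kcomb a j n (s + i) w"
  by (induction i) (simp_all add: kcomb_C1fun)

lemma pairing_coef:
  assumes "g \<in> ksolset a j"
  shows "pairing a j f g = (\<Sum>i<2 * j. \<Sum>l<2 * j.
      (-1) ^ i * omega (coef a j f i) (ksymbol a j (l + i) *v coef a j g l))"
proof -
  have "defect ((D ^^ i) g) = (\<Sum>l<2 * j. ksymbol a j (l + i) *v coef a j g l)" for i
  proof -
    have "(D ^^ i) g = kcomb a j (2 * j) (0 + i) (coef a j g)"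
      using D_iter_kcomb[of i a j "2 * j" 0 "coef a j g"] by (simp only: kcomb_coef[OF assms])
    then show ?thesis by (simp only: defect_kcomb add_0)
  qed
  then show ?thesis
    unfolding pairing_def by (simp only: omega_sum sum_distrib_left)
qed

lemma pairing_skew:
  assumes "f \<in> ksolset a j" "g \<in> ksolset a j"
  shows "pairing a j g f = - pairing a j f g"
proof -
  have "pairing a j g f = (\<Sum>l<2 * j. \<Sum>i<2 * j.
      (-1) ^ l * omega (coef a j g l) (ksymbol a j (i + l) *v coef a j f i))"
    by (rule pairing_coef[OF assms(1)])
  also have "\<dots> = (\<Sum>i<2 * j. \<Sum>l<2 * j.
      (-1) ^ l * omega (coef a j g l) (ksymbol a j (i + l) *v coef a j f i))"
    by (rule sum.swap)
  also have "\<dots> = (\<Sum>i<2 * j. \<Sum>l<2 * j.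
      - ((-1) ^ i * omega (coef a j f i) (ksymbol a j (l + i) *v coef a j g l)))"
  proof (intro sum.cong refl)
    fix i l
    have "(-1) ^ l * (-1) ^ Suc (i + l) = - ((-1) ^ i :: complex)"
      by (cases "even i"; cases "even l") auto
    then show "(-1) ^ l * omega (coef a j g l) (ksymbol a j (i + l) *v coef a j f i)
      = - ((-1) ^ i * omega (coef a j f i) (ksymbol a j (l + i) *v coef a j g l))"
      by (subst omega_ksymbol) (simp only: add.commute mult.assoc[symmetric] minus_mult_left)
  qed
  also have "\<dots> = - pairing a j f g"
    by (simp only: sum_negf pairing_coef[OF assms(2)])
  finally show ?thesis .
qed

lemma alternating_pairing: "cfun.alternating_on (ksolset a j) (pairing a j)"
proof -
  have 1: "pairing a j (f + g) h = pairing a j f h + pairing a j g h"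
    if "f \<in> ksolset a j" "g \<in> ksolset a j" for f g h
    unfolding pairing_def sum.distrib[symmetric]
    using that by (intro sum.cong refl) (simp only: lessThan_iff coef_add omega_linear distrib_left)
  have 2: "pairing a j (cscale c f) h = c * pairing a j f h" if "f \<in> ksolset a j" for c f h
    unfolding pairing_def sum_distrib_left
    using that by (intro sum.cong refl) (simp only: lessThan_iff coef_cscale omega_linear mult.left_commute)
  have 3: "pairing a j f f = 0" if "f \<in> ksolset a j" for f
    using pairing_skew[OF that that] by simp
  show ?thesis
    unfolding cfun.alternating_on_def using 1 2 3 pairing_skew by blast
qed

text \<open>The coefficients of the first argument are arbitrary and \<open>omega\<close> is nondegenerate, so an element
of the radical has vanishing defects of every order below \<open>2j\<close>.\<close>

lemma pairing_radical:
  "{f \<in> ksolset a j. \<forall>g\<in>ksolset a j. pairing a j f g = 0} = sq_kernel a j"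
proof (intro subset_antisym subsetI)
  fix f assume "f \<in> sq_kernel a j"
  then have f: "f \<in> ksolset a j" "\<And>i. defect ((D ^^ i) f) = 0"
    using sq_kernel_subset by (auto simp: sq_kernel_def smooth_dom_def)
  then have "pairing a j f g = 0" if "g \<in> ksolset a j" for g
    using pairing_skew[OF that f(1)] by (simp add: pairing_def f(2) omega_linear)
  with f show "f \<in> {f \<in> ksolset a j. \<forall>g\<in>ksolset a j. pairing a j f g = 0}" by blast
next
  fix f assume f: "f \<in> {f \<in> ksolset a j. \<forall>g\<in>ksolset a j. pairing a j f g = 0}"
  then obtain w where w: "f = kcomb a j (2 * j) 0 w" by (auto simp: ksolset_def)
  have "defect ((D ^^ i) f) = 0" if i: "i < 2 * j" for i
  proof (rule omega_nondegenerate)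
    fix v :: "complex^('n+'n)"
    define g where "g = kcomb a j (2 * j) 0 (\<lambda>l. if l = i then v else 0)"
    have g: "g \<in> ksolset a j" by (simp add: g_def ksolset_def)
    have "pairing a j g f = (\<Sum>l<2 * j. if l = i then (-1) ^ i * omega v (defect ((D ^^ i) f)) else 0)"
      unfolding pairing_def
      by (intro sum.cong refl) (auto simp: g_def coef_kcomb omega_linear)
    also have "\<dots> = (-1) ^ i * omega v (defect ((D ^^ i) f))"
      using i by simp
    finally have "(-1) ^ i * omega v (defect ((D ^^ i) f)) = - pairing a j f g"
      using pairing_skew[of f a j g] f g by simp
    then show "omega v (defect ((D ^^ i) f)) = 0" using f g by simp
  qed
  moreover have "f \<in> smooth" unfolding w by (rule kcomb_smooth)
  moreover have "(sqshift a ^^ j) f = 0" unfolding w by (rule sqshift_iter_kcomb)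
  ultimately show "f \<in> sq_kernel a j"
    using smooth_domI[of f j a] by (simp only: sq_kernel_def mem_Collect_eq simp_thms)
qed

text \<open>The form \<open>B\<close> is nondegenerate, so the parity lemma applies with radical \<open>0\<close>. This spares the
computation of the dimension \<open>4jn\<close>.\<close>

lemma even_dim_ksolset: "even (cfun.dim (ksolset a j :: (real \<Rightarrow> complex^('n+'n)) set))"
proof -
  define B where "B = (\<lambda>f g :: real \<Rightarrow> complex^('n+'n). \<Sum>i<2 * j. omega (coef a j f i) (coef a j g i))"
  have skew: "B g f = - B f g" for f g
    unfolding B_def sum_negf[symmetric] by (intro sum.cong refl omega_skew)
  have "cfun.alternating_on (ksolset a j) B"
  proof -
    have "B (f + g) h = B f h + B g h" if "f \<in> ksolset a j" "g \<in> ksolset a j" for f g h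
      unfolding B_def sum.distrib[symmetric]
      using that by (intro sum.cong refl) (simp only: lessThan_iff coef_add omega_linear)
    moreover have "B (cscale c f) h = c * B f h" if "f \<in> ksolset a j" for c f h
      unfolding B_def sum_distrib_left
      using that by (intro sum.cong refl) (simp only: lessThan_iff coef_cscale omega_linear)
    moreover have "B f f = 0" for f using skew[of f f] by simp
    ultimately show ?thesis unfolding cfun.alternating_on_def using skew by blast
  qed
  moreover have "{f \<in> ksolset a j. \<forall>g\<in>ksolset a j. B f g = 0} = {0}"
  proof (intro subset_antisym subsetI)
    fix f assume f: "f \<in> {f \<in> ksolset a j. \<forall>g\<in>ksolset a j. B f g = 0}"
    have "coef a j f i = 0" if i: "i < 2 * j" for i
    proof (rule omega_nondegenerate)
      fix v :: "complex^('n+'n)"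
      define g where "g = kcomb a j (2 * j) 0 (\<lambda>l. if l = i then v else 0)"
      have g: "g \<in> ksolset a j" by (simp add: g_def ksolset_def)
      have "B g f = (\<Sum>l<2 * j. if l = i then omega v (coef a j f i) else 0)"
        unfolding B_def by (intro sum.cong refl) (auto simp: g_def coef_kcomb omega_linear)
      also have "\<dots> = omega v (coef a j f i)" using i by simp
      finally show "omega v (coef a j f i) = 0" using skew[of g f] f g by simp
    qed
    then have "kcomb a j (2 * j) 0 (coef a j f) = 0"
      by (auto simp: kcomb_def cutoff_def fun_eq_iff)
    then show "f \<in> {0}" using kcomb_coef[of f a j] f by simp
  next
    fix f :: "real \<Rightarrow> complex^('n+'n)" assume "f \<in> {0}"
    then have f0: "f = 0" by simp
    have "B 0 g = 0" if "g \<in> ksolset a j" for g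
    proof -
      have "B (cscale 0 g) g = 0 * B g g"
        unfolding B_def sum_distrib_left
        using that by (intro sum.cong refl) (simp only: lessThan_iff coef_cscale omega_linear)
      then show ?thesis by (simp only: cfun.scale_zero_left mult_zero_left)
    qed
    then show "f \<in> {f \<in> ksolset a j. \<forall>g\<in>ksolset a j. B f g = 0}"
      unfolding f0 using cfun.subspace_0[OF subspace_ksolset] by blast
  qed
  moreover obtain S :: "(real \<Rightarrow> complex^('n+'n)) set" where "finite S" "ksolset a j \<subseteq> cfun.span S"
    using ksolset_finite_dim by blast
  moreover have "cfun.dim {0 :: real \<Rightarrow> complex^('n+'n)} = 0"
    by (rule cfun.dim_unique[of "{}"]) (simp_all add: cfun.independent_empty)
  ultimately show ?thesis
    using cfun.even_dim_iff_even_dim_radical[OF subspace_ksolset, of S a j B] by simp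
qed

theorem even_dim_sq_kernel: "even (cfun.dim (sq_kernel a j))"
proof -
  obtain S :: "(real \<Rightarrow> complex^('n+'n)) set" where S: "finite S" "ksolset a j \<subseteq> cfun.span S"
    using ksolset_finite_dim by blast
  show ?thesis
    using cfun.even_dim_iff_even_dim_radical[OF subspace_ksolset S alternating_pairing]
      even_dim_ksolset by (simp only: pairing_radical)
qed

end

section \<open>Finite ascent at every eigenvalue\<close>

text \<open>Cramer's rule over a commutative ring: \<open>x\<^sub>k det A\<close> is the determinant of \<open>A\<close> with column \<open>k\<close>
replaced by \<open>A x\<close>. The proof works with the rows of the transpose.\<close>

lemma dvd_det_times:
  fixes A :: "'a::comm_ring_1^'n^'n"
  assumes "\<And>i. d dvd (A *v x) $ i"
  shows "d dvd x $ k * det A"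
proof -
  let ?R = "\<lambda>a. (\<chi> i. if i = k then a else row i (transpose A)) :: 'a^'n^'n"
  obtain y where y: "\<And>i. (A *v x) $ i = d * y i"
    using assms unfolding dvd_def by metis
  have comb: "(\<Sum>j\<in>UNIV. x $ j *s row j (transpose A)) = d *s (\<chi> i. y i)"
    using y by (simp add: vec_eq_iff matrix_vector_mult_def row_def transpose_def mult.commute)
  have "det (?R (x $ j *s row j (transpose A))) = (if j = k then x $ k * det A else 0)" for j
  proof -
    have "det (?R (x $ j *s row j (transpose A))) = x $ j * det (?R (row j (transpose A)))"
      by (rule det_row_mul)
    moreover have "det (?R (row j (transpose A))) = 0" if "j \<noteq> k"
      using that by (intro det_identical_rows[of k j]) (auto simp: row_def vec_eq_iff)
    moreover have "det (?R (row j (transpose A))) = det A" if "j = k"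
    proof -
      have "?R (row j (transpose A)) = transpose A"
        using that by (simp add: vec_eq_iff row_def)
      then show ?thesis by (simp add: det_transpose)
    qed
    ultimately show ?thesis by simp
  qed
  then have "x $ k * det A = (\<Sum>j\<in>UNIV. det (?R (x $ j *s row j (transpose A))))"
    by simp
  also have "\<dots> = det (?R (\<Sum>j\<in>UNIV. x $ j *s row j (transpose A)))"
    by (rule det_linear_row_sum[symmetric]) simp
  also have "\<dots> = d * det (?R (\<chi> i. y i))"
    unfolding comb by (rule det_row_mul)
  finally show ?thesis by simp
qed

lemma fps_X_power_dvdI:
  fixes F :: "complex fps"
  assumes "\<And>r. r < n \<Longrightarrow> fps_nth F r = 0"
  shows "fps_X ^ n dvd F"
proof (cases "F = 0")
  case False
  then have "n \<le> subdegree F" using assms by (intro subdegree_geI)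
  then show ?thesis using False by (simp add: fps_dvd_iff)
qed simp

definition entire_fps :: "complex fps \<Rightarrow> bool"
  where "entire_fps F \<longleftrightarrow> fps_conv_radius F = \<infinity>"

lemma entire_fps_intros:
  "entire_fps (fps_const c)" "entire_fps fps_X" "entire_fps (fps_exp c)"
  "entire_fps F \<Longrightarrow> entire_fps G \<Longrightarrow> entire_fps (F + G)"
  "entire_fps F \<Longrightarrow> entire_fps G \<Longrightarrow> entire_fps (F - G)"
  "entire_fps F \<Longrightarrow> entire_fps G \<Longrightarrow> entire_fps (F * G)"
  using fps_conv_radius_add[of F G] fps_conv_radius_diff[of F G] fps_conv_radius_mult[of F G]
  by (auto simp: entire_fps_def)

lemma entire_fps_sum:
  assumes "\<And>i. i \<in> S \<Longrightarrow> entire_fps (F i)"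
  shows "entire_fps (\<Sum>i\<in>S. F i) \<and> eval_fps (\<Sum>i\<in>S. F i) z = (\<Sum>i\<in>S. eval_fps (F i) z)"
  using assms
proof (induction S rule: infinite_finite_induct)
  case (insert i S)
  then show ?case
    using entire_fps_intros(4)[of "F i" "\<Sum>i\<in>S. F i"] by (simp add: entire_fps_def eval_fps_add)
qed (use entire_fps_intros(1)[of 0] in auto)

lemma entire_fps_prod:
  assumes "\<And>i. i \<in> S \<Longrightarrow> entire_fps (F i)"
  shows "entire_fps (\<Prod>i\<in>S. F i) \<and> eval_fps (\<Prod>i\<in>S. F i) z = (\<Prod>i\<in>S. eval_fps (F i) z)"
  using assms
proof (induction S rule: infinite_finite_induct)
  case (insert i S)
  then show ?case
    using entire_fps_intros(6)[of "F i" "\<Prod>i\<in>S. F i"] by (simp add: entire_fps_def eval_fps_mult)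
qed (use entire_fps_intros(1)[of 1] in auto)

text \<open>This transfers nonvanishing from the characteristic function at one point to its expansion at another.\<close>

lemma eval_fps_det:
  fixes A :: "complex fps^'n^'n"
  assumes "\<And>i j. entire_fps (A $ i $ j)"
  shows "eval_fps (det A) z = det (\<chi> i j. eval_fps (A $ i $ j) z)"
proof -
  let ?t = "\<lambda>p. \<Prod>i\<in>UNIV. A $ i $ p i"
  have t: "entire_fps (?t p)" "eval_fps (?t p) z = (\<Prod>i\<in>UNIV. eval_fps (A $ i $ p i) z)" for p
    using entire_fps_prod[of UNIV "\<lambda>i. A $ i $ p i" z] assms by auto
  have s: "of_int (sign p) = fps_const (of_int (sign p) :: complex)" for p :: "'n \<Rightarrow> 'n"
    by (simp add: fps_of_int)
  have "entire_fps (of_int (sign p) * ?t p)"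
    "eval_fps (of_int (sign p) * ?t p) z = of_int (sign p) * (\<Prod>i\<in>UNIV. eval_fps (A $ i $ p i) z)" for p
    unfolding s using t[of p] by (simp_all add: entire_fps_intros) (simp add: entire_fps_def eval_fps_mult)
  then show ?thesis
    unfolding det_def using entire_fps_sum[of "{p. p permutes UNIV}" "\<lambda>p. of_int (sign p) * ?t p" z]
    by simp
qed

text \<open>The functions \<open>texp \<nu> r\<close>, for \<open>r = 0, 1, \<dots>\<close>, form the standard Jordan chain of \<open>D - \<nu>\<close>; they are also the
Taylor coefficients of \<open>exp (z t)\<close> at \<open>z = \<nu>\<close>.\<close>

definition texp :: "complex \<Rightarrow> nat \<Rightarrow> real \<Rightarrow> complex"
  where "texp \<nu> r t = exp (\<nu> * of_real t) * (of_real t ^ r / fact r)"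

lemma texp_deriv:
  "(texp \<nu> 0 has_vector_derivative \<nu> * texp \<nu> 0 t) (at t)"
  "(texp \<nu> (Suc r) has_vector_derivative \<nu> * texp \<nu> (Suc r) t + texp \<nu> r t) (at t)"
proof -
  have "((\<lambda>z. exp (\<nu> * z) * (z ^ 0 / fact 0)) has_field_derivative \<nu> * (exp (\<nu> * z) * (z ^ 0 / fact 0))) (at z)" for z
    by (auto intro!: derivative_eq_intros)
  then show "(texp \<nu> 0 has_vector_derivative \<nu> * texp \<nu> 0 t) (at t)"
    unfolding texp_def[abs_def] by (rule has_vector_derivative_real_field)
  have pow: "((\<lambda>z. z ^ Suc r / fact (Suc r)) has_field_derivative z ^ r / fact r) (at z)" for z :: complex
    using DERIV_cdivide[OF DERIV_power[OF DERIV_ident[of "at z"], where n = "Suc r"], of "fact (Suc r)"]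
    by (simp add: fact_Suc del: of_nat_Suc)
  have exp: "((\<lambda>z. exp (\<nu> * z)) has_field_derivative \<nu> * exp (\<nu> * z)) (at z)" for z
    by (auto intro!: derivative_eq_intros)
  have "((\<lambda>z. exp (\<nu> * z) * (z ^ Suc r / fact (Suc r))) has_field_derivative
      \<nu> * (exp (\<nu> * z) * (z ^ Suc r / fact (Suc r))) + exp (\<nu> * z) * (z ^ r / fact r)) (at z)" for z
    using DERIV_mult'[OF exp pow, of z] by (simp only: ac_simps)
  then show "(texp \<nu> (Suc r) has_vector_derivative \<nu> * texp \<nu> (Suc r) t + texp \<nu> r t) (at t)"
    unfolding texp_def[abs_def] by (rule has_vector_derivative_real_field)
qed

lemma continuous_texp: "continuous_on UNIV (texp \<nu> r)"
  unfolding texp_def[abs_def] by (intro continuous_intros) auto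

context centred_interval
begin

definition linshift :: "complex \<Rightarrow> (real \<Rightarrow> complex^'m) \<Rightarrow> (real \<Rightarrow> complex^'m)"
  where "linshift \<nu> \<phi> = dfun T \<phi> - cscale \<nu> \<phi>"

lemma linshift_smooth: "\<phi> \<in> smooth \<Longrightarrow> linshift \<nu> \<phi> \<in> smooth"
  unfolding linshift_def
  by (intro cfun.subspace_diff cfun.subspace_scale subspace_smooth smoothD)

lemma linshift_iter_smooth: "\<phi> \<in> smooth \<Longrightarrow> (linshift \<nu> ^^ i) \<phi> \<in> smooth"
  by (induction i) (auto intro: linshift_smooth)

lemma linshift_add:
  assumes "\<phi> \<in> C1fun T" "\<psi> \<in> C1fun T"
  shows "linshift \<nu> (\<phi> + \<psi>) = linshift \<nu> \<phi> + linshift \<nu> \<psi>"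
  using assms unfolding linshift_def
  by (simp only: C1fun_add cfun.scale_right_distrib add_diff_add)

lemma linshift_0: "linshift \<nu> 0 = 0"
  unfolding linshift_def by (simp only: C1fun_0 cfun.scale_zero_right diff_self)

lemma linshift_commute:
  fixes \<phi> :: "real \<Rightarrow> complex^'m"
  assumes "\<phi> \<in> smooth"
  shows "linshift \<nu> (linshift \<mu> \<phi>) = linshift \<mu> (linshift \<nu> \<phi>)"
proof -
  have "dfun T (linshift \<alpha> \<phi>) = dfun T (dfun T \<phi>) - cscale \<alpha> (dfun T \<phi>)" for \<alpha>
    using assms unfolding linshift_def by (simp only: C1fun_diff C1fun_cscale smoothD)
  then show ?thesis
    unfolding linshift_def[of _ "linshift _ _"]
    by (simp add: linshift_def cfun.scale_right_diff_distrib mult.commute algebra_simps)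
qed

lemma sqshift_linshift:
  fixes \<phi> :: "real \<Rightarrow> complex^'m"
  assumes "\<phi> \<in> C1fun T" "dfun T \<phi> \<in> C1fun T"
  shows "sqshift (r * r) \<phi> = linshift r (linshift (- r) \<phi>)"
proof -
  have "dfun T (linshift (- r) \<phi>) = dfun T (dfun T \<phi>) - cscale (- r) (dfun T \<phi>)"
    using assms unfolding linshift_def by (simp only: C1fun_diff C1fun_cscale)
  then show ?thesis
    unfolding linshift_def[of _ "linshift _ _"] sqshift_def
    by (simp add: linshift_def cfun.scale_right_diff_distrib cfun.scale_minus_left algebra_simps)
qed

lemma linshift_iter_commute1:
  fixes \<phi> :: "real \<Rightarrow> complex^'m"
  assumes "\<phi> \<in> smooth"
  shows "linshift \<nu> ((linshift \<mu> ^^ j) \<phi>) = (linshift \<mu> ^^ j) (linshift \<nu> \<phi>)"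
proof (induction j)
  case (Suc j)
  have "linshift \<nu> ((linshift \<mu> ^^ Suc j) \<phi>) = linshift \<mu> (linshift \<nu> ((linshift \<mu> ^^ j) \<phi>))"
    unfolding funpow.simps comp_apply by (rule linshift_commute[OF linshift_iter_smooth[OF assms]])
  then show ?case by (simp only: Suc funpow.simps comp_apply)
qed (simp only: funpow_0)

lemma linshift_iter_commute:
  fixes \<phi> :: "real \<Rightarrow> complex^'m"
  assumes "\<phi> \<in> smooth"
  shows "(linshift \<nu> ^^ i) ((linshift \<mu> ^^ j) \<phi>) = (linshift \<mu> ^^ j) ((linshift \<nu> ^^ i) \<phi>)"
proof (induction i)
  case (Suc i)
  show ?case
    unfolding funpow.simps comp_apply Suc
    by (rule linshift_iter_commute1[OF linshift_iter_smooth[OF assms]])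
qed (simp only: funpow_0)

lemma sqshift_iter_linshift:
  fixes \<phi> :: "real \<Rightarrow> complex^'m"
  assumes "\<phi> \<in> smooth"
  shows "(sqshift (r * r) ^^ j) \<phi> = (linshift r ^^ j) ((linshift (- r) ^^ j) \<phi>)"
proof (induction j)
  case (Suc j)
  let ?q = "(linshift (- r) ^^ j) \<phi>"
  have q: "?q \<in> smooth" by (rule linshift_iter_smooth[OF assms])
  have "(sqshift (r * r) ^^ Suc j) \<phi> = linshift r (linshift (- r) ((linshift r ^^ j) ?q))"
    unfolding funpow.simps comp_apply Suc 
    by (rule sqshift_linshift) (intro smoothD linshift_iter_smooth q)+
  also have "\<dots> = linshift r ((linshift r ^^ j) (linshift (- r) ?q))"
    by (simp only: linshift_iter_commute1[OF q])
  finally show ?case by (simp only: funpow.simps comp_apply)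
qed (simp only: funpow_0)

definition texpfun :: "complex \<Rightarrow> nat \<Rightarrow> complex^'m \<Rightarrow> real \<Rightarrow> complex^'m"
  where "texpfun \<nu> r v = cutoff T (\<lambda>t. texp \<nu> r t *s v)"

lemma texpfun_0: "texpfun \<nu> 0 v = expfun \<nu> v"
  by (simp add: texpfun_def expfun_def texp_def)

lemma texpfun_Suc:
  "texpfun \<nu> (Suc r) v \<in> C1fun T"
  "dfun T (texpfun \<nu> (Suc r) v) = cscale \<nu> (texpfun \<nu> (Suc r) v) + texpfun \<nu> r v"
proof -
  have 1: "((\<lambda>t. texp \<nu> (Suc r) t *s v) has_vector_derivative
      (\<nu> * texp \<nu> (Suc r) t + texp \<nu> r t) *s v) (at t)" for t
    using vsmult_has_vector_derivative[OF texp_deriv(2)[of \<nu> r t] has_vector_derivative_const[of v]]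
    by simp
  have 2: "continuous_on UNIV (\<lambda>t. (\<nu> * texp \<nu> (Suc r) t + texp \<nu> r t) *s v)"
    by (intro vsmult_continuous_on continuous_intros continuous_texp)
  show "texpfun \<nu> (Suc r) v \<in> C1fun T"
    unfolding texpfun_def by (rule dfun_cutoff(1)[OF 1 2])
  have "dfun T (texpfun \<nu> (Suc r) v) = cutoff T (\<lambda>t. (\<nu> * texp \<nu> (Suc r) t + texp \<nu> r t) *s v)"
    unfolding texpfun_def by (rule dfun_cutoff(2)[OF 1 2])
  then show "dfun T (texpfun \<nu> (Suc r) v) = cscale \<nu> (texpfun \<nu> (Suc r) v) + texpfun \<nu> r v"
    by (simp add: texpfun_def cutoff_def cscale_def fun_eq_iff vector_sadd_rdistrib vector_smult_assoc)
qed

lemma texpfun_C1fun: "texpfun \<nu> r v \<in> C1fun T"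
  by (cases r) (simp_all only: texpfun_0 expfun_C1fun texpfun_Suc)

lemma linshift_texpfun: "linshift \<nu> (texpfun \<nu> 0 v) = 0" "linshift \<nu> (texpfun \<nu> (Suc r) v) = texpfun \<nu> r v"
  unfolding linshift_def by (simp_all only: texpfun_0 expfun_C1fun texpfun_Suc diff_self add_diff_cancel_left')

definition jordan :: "complex \<Rightarrow> nat \<Rightarrow> (nat \<Rightarrow> complex^'m) \<Rightarrow> real \<Rightarrow> complex^'m"
  where "jordan \<nu> n v = (\<Sum>i<n. texpfun \<nu> i (v i))"

lemma sum_texpfun_C1fun: "(\<Sum>i\<in>S. texpfun \<nu> (k i) (v i)) \<in> C1fun T"
  by (intro cfun.subspace_sum subspace_C1fun texpfun_C1fun)

lemma linshift_sum_texpfun: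
  "linshift \<nu> (\<Sum>i<n. texpfun \<nu> (k i) (v i)) = (\<Sum>i<n::nat. linshift \<nu> (texpfun \<nu> (k i) (v i)))"
  by (induction n) (simp_all only: lessThan_0 sum.empty linshift_0 sum.lessThan_Suc
      linshift_add[OF sum_texpfun_C1fun texpfun_C1fun])

lemma jordan_Suc: "jordan \<nu> (Suc n) v = texpfun \<nu> 0 (v 0) + (\<Sum>i<n. texpfun \<nu> (Suc i) (v (Suc i)))"
  unfolding jordan_def by (rule sum.lessThan_Suc_shift)

lemma linshift_jordan: "linshift \<nu> (jordan \<nu> (Suc n) v) = jordan \<nu> n (\<lambda>i. v (Suc i))"
  unfolding jordan_Suc linshift_add[OF texpfun_C1fun sum_texpfun_C1fun] linshift_sum_texpfun linshift_texpfun
  by (simp only: add_0 jordan_def)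

lemma linshift_iter_jordan:
  "s \<le> n \<Longrightarrow> (linshift \<nu> ^^ s) (jordan \<nu> n v) = jordan \<nu> (n - s) (\<lambda>i. v (i + s))"
proof (induction s)
  case (Suc s)
  then have "n - s = Suc (n - Suc s)" by simp
  then have "linshift \<nu> (jordan \<nu> (n - s) (\<lambda>i. v (i + s))) = jordan \<nu> (n - Suc s) (\<lambda>i. v (Suc i + s))"
    by (simp only: linshift_jordan)
  then show ?case using Suc by (simp only: funpow.simps comp_apply Suc_leD add_Suc_shift)
qed (simp only: funpow_0 diff_zero add_0_right)

lemma linshift_iter_solution:
  fixes \<phi> :: "real \<Rightarrow> complex^'m"
  assumes "\<phi> \<in> smooth" "(linshift \<nu> ^^ n) \<phi> = 0"
  shows "\<exists>v. \<phi> = jordan \<nu> n v"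
  using assms
proof (induction n arbitrary: \<phi>)
  case 0
  have "\<phi> = 0" using "0"(2) by (simp only: funpow_0)
  then show ?case by (simp only: jordan_def lessThan_0 sum.empty simp_thms)
next
  case (Suc n)
  have "(linshift \<nu> ^^ n) (linshift \<nu> \<phi>) = 0"
    using Suc.prems(2) by (simp only: funpow_Suc_right comp_apply)
  then obtain w where w: "linshift \<nu> \<phi> = jordan \<nu> n w"
    using Suc.IH[OF linshift_smooth[OF Suc.prems(1)]] by blast
  define g where "g = (\<Sum>i<n. texpfun \<nu> (Suc i) (w i))"
  have g: "g \<in> C1fun T" unfolding g_def by (rule sum_texpfun_C1fun)
  have p: "\<phi> \<in> C1fun T" using Suc.prems(1) by (rule smoothD)
  have "linshift \<nu> g = jordan \<nu> n w"
    unfolding g_def linshift_sum_texpfun linshift_texpfun jordan_def ..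
  then have "dfun T \<phi> - dfun T g = cscale \<nu> \<phi> - cscale \<nu> g"
    using w unfolding linshift_def by (simp add: algebra_simps)
  then have "dfun T (\<phi> - g) = cscale \<nu> (\<phi> - g)"
    by (simp only: C1fun_diff[OF p g] cfun.scale_right_diff_distrib)
  then have "\<phi> - g = expfun \<nu> ((\<phi> - g) 0)"
    by (rule first_order_solution[OF C1fun_diff(1)[OF p g]])
  then have "\<phi> = texpfun \<nu> 0 ((\<phi> - g) 0) + g"
    unfolding texpfun_0 by (simp only: diff_eq_eq)
  also have "\<dots> = jordan \<nu> (Suc n) (\<lambda>i. case i of 0 \<Rightarrow> (\<phi> - g) 0 | Suc i \<Rightarrow> w i)"
    unfolding jordan_Suc g_def by (simp only: nat.case)
  finally show ?case by blast
qed

end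

context hamiltonian_delay
begin

text \<open>The Taylor coefficient of order \<open>r\<close> of the characteristic matrix at \<open>\<nu>\<close>.\<close>

definition tsymbol :: "complex \<Rightarrow> nat \<Rightarrow> complex^('n+'n)^('n+'n)"
  where "tsymbol \<nu> r = symbol (if r = 0 then \<nu> else if r = 1 then 1 else 0) (texp \<nu> r)"

lemma defect_texpfun: "defect (texpfun \<nu> r v) = tsymbol \<nu> r *v v"
proof -
  have "D (texpfun \<nu> r v) 0 = (if r = 0 then \<nu> else if r = 1 then 1 else 0) *s v"
  proof -
    have at_0: "texpfun \<nu> r v 0 = (if r = 0 then v else 0)" for r
      using T_pos by (simp add: texpfun_def cutoff_def texp_def power_0_left)
    show ?thesis
    proof (cases r)
      case 0
      then show ?thesis unfolding 0 texpfun_0 expfun_C1fun by (simp add: cscale_def)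
    next
      case (Suc q)
      then show ?thesis
        unfolding Suc texpfun_Suc plus_fun_apply cscale_def by (simp add: at_0)
    qed
  qed
  then show ?thesis
    unfolding defect_def tsymbol_def symbol_apply[symmetric] by (simp only: texpfun_def)
qed

lemma defect_jordan: "defect (jordan \<nu> n v) = (\<Sum>i<n. tsymbol \<nu> i *v v i)"
  unfolding jordan_def
  by (induction n) (simp_all only: lessThan_0 sum.empty defect_0 sum.lessThan_Suc
      defect_add[OF sum_texpfun_C1fun texpfun_C1fun] defect_texpfun)

text \<open>The Taylor expansion of the characteristic matrix at \<open>\<nu>\<close>.\<close>

definition charfps :: "complex \<Rightarrow> complex fps^('n+'n)^('n+'n)"
  where "charfps \<nu> = (\<chi> i j. (fps_const \<nu> + fps_X) * fps_const (if i = j then 1 else 0)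
    - fps_const (of_real (H 0 $ i $ j))
    - (\<Sum>k=1..K. fps_const (exp (\<nu> * of_real (- \<tau> k)) * of_real (H (- int k) $ i $ j)) * fps_exp (of_real (- \<tau> k))
        + fps_const (exp (\<nu> * of_real (\<tau> k)) * of_real (H (int k) $ i $ j)) * fps_exp (of_real (\<tau> k))))"

lemma charfps_nth: "fps_nth (charfps \<nu> $ i $ j) r = tsymbol \<nu> r $ i $ j"
  by (auto simp: charfps_def tsymbol_def symbol_def texp_def fps_sum_nth distrib_right power_0_left mult_ac)

lemma charfps_entire: "entire_fps (charfps \<nu> $ i $ j)"
  unfolding charfps_def vec_lambda_beta
  by (intro entire_fps_intros entire_fps_sum[THEN conjunct1])

lemma eval_charfps: "eval_fps (charfps \<nu> $ i $ j) z = charmat (\<nu> + z) $ i $ j"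
proof -
  have c: "fps_conv_radius F = \<infinity>" if "entire_fps F" for F using that by (simp add: entire_fps_def)
  note ent = entire_fps_intros entire_fps_sum[THEN conjunct1]
  show ?thesis
    by (simp add: charfps_def charmat_def symbol_def eval_fps_add eval_fps_diff eval_fps_mult
        entire_fps_sum[THEN conjunct2] c ent distrib_right distrib_left exp_add exp_minus exp_diff mult_ac
        divide_inverse)
qed

lemma det_charfps_nonzero:
  assumes "det (charmat \<sigma>) \<noteq> 0"
  shows "det (charfps \<nu>) \<noteq> 0"
proof
  assume "det (charfps \<nu>) = 0"
  then have "eval_fps (det (charfps \<nu>)) (\<sigma> - \<nu>) = 0" by simp
  then have "det (\<chi> i j. charmat \<sigma> $ i $ j) = 0"
    by (simp add: eval_fps_det charfps_entire eval_charfps)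
  then show False using assms by simp
qed

lemma linshift_smooth_dom: "\<phi> \<in> smooth_dom \<Longrightarrow> linshift \<nu> \<phi> \<in> smooth_dom"
  unfolding linshift_def
  by (intro cfun.subspace_diff cfun.subspace_scale subspace_smooth_dom D_smooth_dom)

lemma linshift_iter_smooth_dom: "\<phi> \<in> smooth_dom \<Longrightarrow> (linshift \<nu> ^^ i) \<phi> \<in> smooth_dom"
  by (induction i) (auto intro: linshift_smooth_dom)

text \<open>Write \<open>\<phi> = \<Sum>i\<le>N. texp \<nu> i v\<^sub>i\<close>. The conditions on \<open>\<phi>\<close> and its images under powers of \<open>D - \<nu>\<close> say that
\<open>M(\<nu> + X) V\<close> is divisible by \<open>X\<^bsup>N+1\<^esup>\<close> for the reversed coefficient series \<open>V\<close>. If the top coefficient \<open>v\<^sub>N\<close>,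
the constant term of \<open>V\<close>, were nonzero, Cramer's rule would make \<open>det M(\<nu> + X)\<close> divisible by
\<open>X\<^bsup>N+1\<^esup>\<close>, against the choice of \<open>N\<close>.\<close>

lemma ascent_step:
  assumes det: "det (charfps \<nu>) \<noteq> 0" and N: "N = subdegree (det (charfps \<nu>))"
    and p: "\<phi> \<in> smooth_dom" "(linshift \<nu> ^^ Suc N) \<phi> = 0"
  shows "(linshift \<nu> ^^ N) \<phi> = 0"
proof -
  obtain v where v: "\<phi> = jordan \<nu> (Suc N) v"
    using linshift_iter_solution p smooth_dom_smooth by blast
  have chain: "(\<Sum>i<Suc N - s. tsymbol \<nu> i *v v (i + s)) = 0" if "s \<le> N" for s
  proof -
    have "(linshift \<nu> ^^ s) \<phi> \<in> smooth_dom" by (rule linshift_iter_smooth_dom[OF p(1)])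
    then have "defect ((linshift \<nu> ^^ s) \<phi>) = 0"
      using smooth_dom_domH domH_iff by blast
    then show ?thesis
      unfolding v using that by (simp only: linshift_iter_jordan le_SucI defect_jordan)
  qed
  \<comment> \<open>reversed order: the constant term of \<open>V\<close> is the top coefficient \<open>v N\<close>\<close>
  define V where "V = (\<chi> k. Abs_fps (\<lambda>r. v (N - r) $ k))"
  have "fps_X ^ Suc N dvd (charfps \<nu> *v V) $ i" for i
  proof (rule fps_X_power_dvdI)
    fix r assume r: "r < Suc N"
    have "fps_nth ((charfps \<nu> *v V) $ i) r
        = (\<Sum>j\<in>UNIV. \<Sum>q=0..r. tsymbol \<nu> q $ i $ j * v (N - (r - q)) $ j)"
      by (simp add: matrix_vector_mult_def V_def fps_sum_nth fps_mult_nth charfps_nth)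
    also have "\<dots> = (\<Sum>q=0..r. \<Sum>j\<in>UNIV. tsymbol \<nu> q $ i $ j * v (N - (r - q)) $ j)"
      by (rule sum.swap)
    also have "\<dots> = (\<Sum>q<Suc N - (N - r). \<Sum>j\<in>UNIV. tsymbol \<nu> q $ i $ j * v (q + (N - r)) $ j)"
    proof (rule sum.cong)
      show "{0..r} = {..<Suc N - (N - r)}" using r by auto
      fix q assume "q \<in> {..<Suc N - (N - r)}"
      then have "N - (r - q) = q + (N - r)" using r by auto
      then show "(\<Sum>j\<in>UNIV. tsymbol \<nu> q $ i $ j * v (N - (r - q)) $ j)
          = (\<Sum>j\<in>UNIV. tsymbol \<nu> q $ i $ j * v (q + (N - r)) $ j)" by simp
    qed
    also have "\<dots> = (\<Sum>q<Suc N - (N - r). tsymbol \<nu> q *v v (q + (N - r))) $ i"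
      by (simp add: matrix_vector_mult_def)
    finally show "fps_nth ((charfps \<nu> *v V) $ i) r = 0"
      using chain[of "N - r"] by simp
  qed
  then have dvd: "fps_X ^ Suc N dvd V $ k * det (charfps \<nu>)" for k
    by (rule dvd_det_times)
  have "v N $ k = 0" for k
  proof (rule ccontr)
    assume "v N $ k \<noteq> 0"
    then have k: "fps_nth (V $ k) 0 \<noteq> 0" by (simp add: V_def)
    then have k0: "V $ k \<noteq> 0" by auto
    have "subdegree (V $ k * det (charfps \<nu>)) = N"
      using k k0 det N by simp
    moreover have "V $ k * det (charfps \<nu>) \<noteq> 0" using k0 det by simp
    ultimately show False
      using dvd[of k] fps_dvd_iff[of "fps_X ^ Suc N" "V $ k * det (charfps \<nu>)"] 
      by (simp del: power_Suc)
  qed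
  then have "v N = 0" by (simp add: vec_eq_iff)
  moreover have "(linshift \<nu> ^^ N) \<phi> = jordan \<nu> (Suc N - N) (\<lambda>i. v (i + N))"
    unfolding v by (rule linshift_iter_jordan) simp
  moreover have "jordan \<nu> (Suc N - N) (\<lambda>i. v (i + N)) = texpfun \<nu> 0 (v N)"
    by (simp add: jordan_def Suc_diff_le)
  ultimately show ?thesis
    by (auto simp: texpfun_def cutoff_def)
qed

lemma ascent:
  assumes "det (charfps \<nu>) \<noteq> 0" "\<phi> \<in> smooth_dom" "(linshift \<nu> ^^ n) \<phi> = 0"
    and N: "subdegree (det (charfps \<nu>)) \<le> N"
  shows "(linshift \<nu> ^^ N) \<phi> = 0"
proof -
  let ?N = "subdegree (det (charfps \<nu>))"
  have up: "(linshift \<nu> ^^ (m + i)) \<psi> = 0" if "(linshift \<nu> ^^ m) \<psi> = 0" for m i \<psi>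
    using that by (induction i) (simp_all only: add_0_right add_Suc_right funpow.simps comp_apply linshift_0)
  have "(linshift \<nu> ^^ ?N) \<phi> = 0"
    using assms(3)
  proof (induction n)
    case 0
    then show ?case using up[of 0 \<phi> ?N] by (simp only: add_0)
  next
    case (Suc m)
    show ?case
    proof (cases "Suc m \<le> ?N")
      case True
      then show ?thesis using up[OF Suc.prems, of "?N - Suc m"] by simp
    next
      case False
      \<comment> \<open>one application of \<open>ascent_step\<close> to an image of \<open>\<phi>\<close> lowers the exponent by one\<close>
      then have m: "m = ?N + (m - ?N)" "Suc m = Suc ?N + (m - ?N)" by simp_all
      have "(linshift \<nu> ^^ Suc ?N) ((linshift \<nu> ^^ (m - ?N)) \<phi>) = 0"
        using Suc.prems m(2) by (metis funpow_add comp_apply)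
      then have "(linshift \<nu> ^^ ?N) ((linshift \<nu> ^^ (m - ?N)) \<phi>) = 0"
        by (rule ascent_step[OF assms(1) refl linshift_iter_smooth_dom[OF assms(2)]])
      then have "(linshift \<nu> ^^ m) \<phi> = 0"
        using m(1) by (metis funpow_add comp_apply)
      then show ?thesis by (rule Suc.IH)
    qed
  qed
  then show ?thesis using up[of ?N \<phi> "N - ?N"] N by simp
qed

text \<open>With \<open>a = r\<^sup>2\<close> the operator \<open>(D\<^sup>2 - a)\<^sup>j\<close> is \<open>(D - r)\<^sup>j (D + r)\<^sup>j\<close>, and the exponent of each commuting factor
can be lowered to the ascent at \<open>r\<close> and at \<open>-r\<close> respectively.\<close>

lemma sq_kernel_stabilises:
  assumes "det (charmat \<sigma>) \<noteq> 0"
  shows "\<exists>N. (\<Union>j. sq_kernel a j) = sq_kernel a N"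
proof -
  define r where "r = csqrt a"
  have a: "a = r * r" using power2_csqrt[of a] by (simp add: r_def power2_eq_square)
  have dp: "det (charfps r) \<noteq> 0" and dm: "det (charfps (- r)) \<noteq> 0"
    using det_charfps_nonzero[OF assms] by blast+
  define N where "N = max (subdegree (det (charfps r))) (subdegree (det (charfps (- r))))"
  have "sq_kernel a j \<subseteq> sq_kernel a N" for j
  proof
    fix \<phi> assume "\<phi> \<in> sq_kernel a j"
    then have p: "\<phi> \<in> smooth_dom" and 0: "(sqshift a ^^ j) \<phi> = 0" by (auto simp: sq_kernel_def)
    note s = smooth_dom_smooth[OF p]
    have "(linshift r ^^ j) ((linshift (- r) ^^ j) \<phi>) = 0"
      using 0 sqshift_iter_linshift[OF s, of j r] a by (simp only:)
    then have "(linshift r ^^ N) ((linshift (- r) ^^ j) \<phi>) = 0"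
      by (rule ascent[OF dp linshift_iter_smooth_dom[OF p]]) (simp add: N_def)
    then have "(linshift (- r) ^^ j) ((linshift r ^^ N) \<phi>) = 0"
      by (simp only: linshift_iter_commute[OF s])
    then have "(linshift (- r) ^^ N) ((linshift r ^^ N) \<phi>) = 0"
      by (rule ascent[OF dm linshift_iter_smooth_dom[OF p]]) (simp add: N_def)
    then have "(sqshift a ^^ N) \<phi> = 0"
      unfolding a sqshift_iter_linshift[OF s] by (simp only: linshift_iter_commute[OF s])
    then show "\<phi> \<in> sq_kernel a N" using p by (simp only: sq_kernel_def mem_Collect_eq simp_thms)
  qed
  then show ?thesis by blast
qed

end

section \<open>The inverse of the shifted square\<close>

text \<open>The eigenspace lies in the generalised eigenspace, which has dimension one.\<close>

lemma eigenspace_simple: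
  assumes simple: "simple_eigenvalue S A \<nu>" and ef: "eigenfunction S A \<nu> \<phi>"
    and psi: "\<psi> \<in> eigenspace S A \<nu>"
  shows "\<psi> \<in> cfun.span {\<phi>}"
proof (rule ccontr)
  assume not_in: "\<psi> \<notin> cfun.span {\<phi>}"
  define G where "G = (\<Union>j. ker_pow S A \<nu> j)"
  have "x \<in> ker_pow S A \<nu> (Suc 0)" if "x \<in> eigenspace S A \<nu>" for x
    using that by (simp add: eigenspace_def)
  then have sub: "{\<psi>, \<phi>} \<subseteq> G"
    using psi ef unfolding G_def eigenfunction_def by blast
  have dimG: "cfun.dim G = 1"
    using simple unfolding simple_eigenvalue_def alg_mult_def G_def[symmetric] Let_def
    by (auto split: if_splits simp: one_enat_def)
  obtain C where C: "C \<subseteq> G" "cfun.independent C" "G \<subseteq> cfun.span C" "card C = 1"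
    using cfun.basis_exists[of G] dimG by metis
  have ind: "cfun.independent {\<psi>, \<phi>}"
    using not_in ef by (intro cfun.independent_insertI) (auto simp: eigenfunction_def cfun.independent_empty)
  have "card {\<psi>, \<phi>} \<le> card C"
    using cfun.independent_span_bound[OF _ ind, of C] C sub card_ge_0_finite[of C] by auto
  moreover have "\<psi> \<noteq> \<phi>" using not_in cfun.span_base by blast
  ultimately show False using C(4) by simp
qed

context hamiltonian_delay
begin

lemma opR_sqshift: "opR K \<tau> \<sigma> \<phi> = sqshift (\<sigma> * \<sigma>) \<phi>"
  by (simp add: opR_def sqshift_def power2_eq_square)

lemma domR_C1: "\<phi> \<in> domR K \<tau> H \<Longrightarrow> \<phi> \<in> C1fun (\<tau> K)" "\<phi> \<in> domR K \<tau> H \<Longrightarrow> D \<phi> \<in> C1fun (\<tau> K)"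
  by (simp_all add: domR_iff domH_iff)

lemma domR_domH: "\<phi> \<in> domR K \<tau> H \<Longrightarrow> \<phi> \<in> domH K \<tau> H"
  by (simp only: domR_iff)

lemma sqshift_diff:
  assumes "\<phi> \<in> domR K \<tau> H" "\<psi> \<in> domR K \<tau> H"
  shows "sqshift a (\<phi> - \<psi>) = sqshift a \<phi> - sqshift a \<psi>"
  unfolding sqshift_def C1fun_diff[OF domR_C1(1)[OF assms(1)] domR_C1(1)[OF assms(2)]]
    C1fun_diff[OF domR_C1(2)[OF assms(1)] domR_C1(2)[OF assms(2)]]
  by (simp add: cfun.scale_right_diff_distrib)

lemma sqshift_cscale:
  assumes "\<phi> \<in> domR K \<tau> H"
  shows "sqshift a (cscale c \<phi>) = cscale c (sqshift a \<phi>)"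
  unfolding sqshift_def C1fun_cscale[OF domR_C1(1)[OF assms]] C1fun_cscale[OF domR_C1(2)[OF assms]]
  by (simp only: cfun.scale_right_diff_distrib cfun.scale_left_commute)

lemma sqshift_add:
  assumes "\<phi> \<in> domR K \<tau> H" "\<psi> \<in> domR K \<tau> H"
  shows "sqshift a (\<phi> + \<psi>) = sqshift a \<phi> + sqshift a \<psi>"
  unfolding sqshift_def C1fun_add[OF domR_C1(1)[OF assms(1)] domR_C1(1)[OF assms(2)]]
    C1fun_add[OF domR_C1(2)[OF assms(1)] domR_C1(2)[OF assms(2)]]
  by (simp only: cfun.scale_right_distrib add_diff_add)

lemma sqshift_zero: "sqshift a 0 = 0"
  unfolding sqshift_def by (simp only: C1fun_0 cfun.scale_zero_right diff_self)

lemma subspace_domR: "cfun.subspace (domR K \<tau> H)"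
proof (rule cfun.subspaceI)
  show "0 \<in> domR K \<tau> H"
    using cfun.subspace_0[OF subspace_domH] by (simp only: domR_iff C1fun_0 simp_thms)
  show "x + y \<in> domR K \<tau> H" if "x \<in> domR K \<tau> H" "y \<in> domR K \<tau> H" for x y
    using that cfun.subspace_add[OF subspace_domH] domR_C1[OF that(1)] domR_C1[OF that(2)]
    by (simp only: domR_iff C1fun_add simp_thms)
  show "cscale c x \<in> domR K \<tau> H" if "x \<in> domR K \<tau> H" for c x
    using that cfun.subspace_scale[OF subspace_domH] domR_C1[OF that]
    by (simp only: domR_iff C1fun_cscale simp_thms)
qed

lemma linshift_domR: "\<phi> \<in> domR K \<tau> H \<Longrightarrow> linshift \<nu> \<phi> \<in> domH K \<tau> H"
  unfolding linshift_def domR_iff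
  by (intro cfun.subspace_diff cfun.subspace_scale subspace_domH) auto

lemma linshift_eq_0_iff: "linshift \<nu> \<phi> = 0 \<longleftrightarrow> D \<phi> = cscale \<nu> \<phi>"
  by (simp add: linshift_def)

lemma linshift_injective:
  assumes "det (charmat \<nu>) \<noteq> 0" "\<phi> \<in> domH K \<tau> H" "linshift \<nu> \<phi> = 0"
  shows "\<phi> = 0"
proof (rule ccontr)
  assume "\<phi> \<noteq> 0"
  then have "eigenfunction (domH K \<tau> H) (opH K \<tau>) \<nu> \<phi>"
    using assms(2,3) by (auto simp: eigenfunction_def eigenspace_def opH_def linshift_eq_0_iff)
  then show False
    using assms(1) eigenvalue_iff_det unfolding eigenvalue_def by blast
qed

text \<open>Correct an arbitrary solution of the differential equation by \<open>exp (\<nu> t) v\<close>, which changes the defect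
by \<open>M(\<nu>) v\<close>.\<close>

lemma linshift_surjective:
  assumes "det (charmat \<nu>) \<noteq> 0" "f \<in> contfun (\<tau> K)"
  obtains \<phi> where "\<phi> \<in> domH K \<tau> H" "linshift \<nu> \<phi> = f"
proof -
  obtain g where g: "g \<in> C1fun (\<tau> K)" "D g = cscale \<nu> g + f"
    using first_order_solvable[OF assms(2)] by blast
  obtain B where B: "charmat \<nu> ** B = mat 1"
    using assms(1) by (auto simp: invertible_det_nz[symmetric] invertible_def)
  define v where "v = B *v (- defect g)"
  have v: "charmat \<nu> *v v = - defect g"
    by (simp add: v_def matrix_vector_mul_assoc B)
  let ?p = "g + expfun \<nu> v"
  have "?p \<in> domH K \<tau> H"
    unfolding domH_iff
    by (simp only: C1fun_add g expfun_C1fun defect_add defect_expfun v right_minus simp_thms)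
  moreover have "linshift \<nu> ?p = f"
    unfolding linshift_def C1fun_add(2)[OF g(1) expfun_C1fun(1)] expfun_C1fun(2) g(2) cfun.scale_right_distrib
    by simp
  ultimately show thesis using that by blast
qed

lemma domR_contfun: "\<phi> \<in> domR K \<tau> H \<Longrightarrow> \<phi> \<in> contfun (\<tau> K)"
  by (rule C1funD(4)[OF domR_C1(1)])

lemma opR_sqshift_plus:
  assumes "a = \<sigma>\<^sup>2 + \<rho>"
  shows "opR K \<tau> \<sigma> \<phi> = sqshift a \<phi> + cscale \<rho> \<phi>"
  unfolding opR_def sqshift_def assms cfun.scale_left_distrib by simp

lemma sq_kernel_eq: "sq_kernel a j = smooth_dom \<inter> ksolset a j"
proof
  have "(sqshift a ^^ j) \<phi> = 0" if "\<phi> \<in> ksolset a j" for \<phi> :: "real \<Rightarrow> complex^('n+'n)"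
    using that unfolding ksolset_def by (elim rangeE) (simp only: sqshift_iter_kcomb)
  then show "smooth_dom \<inter> ksolset a j \<subseteq> sq_kernel a j"
    unfolding sq_kernel_def by blast
qed (use sq_kernel_subset in \<open>auto simp: sq_kernel_def\<close>)

lemma subspace_sq_kernel: "cfun.subspace (sq_kernel a j)"
  unfolding sq_kernel_eq by (rule cfun.subspace_inter[OF subspace_smooth_dom subspace_ksolset])

lemma smooth_dom_domR: "\<phi> \<in> smooth_dom \<Longrightarrow> \<phi> \<in> domR K \<tau> H"
  by (simp add: domR_iff smooth_dom_domH D_smooth_dom)

lemma sq_kernel_Suc: "\<phi> \<in> sq_kernel a (Suc j) \<longleftrightarrow> \<phi> \<in> domR K \<tau> H \<and> sqshift a \<phi> \<in> sq_kernel a j"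
proof -
  have "opR K \<tau> 0 \<phi> - cscale a \<phi> = sqshift a \<phi>"
    by (simp add: opR_sqshift_plus[of a 0 a])
  then show ?thesis
    unfolding ker_pow_R[of a 0 a, simplified, symmetric] ker_pow.simps by simp
qed

lemma sqshift_sq_kernel: "\<phi> \<in> sq_kernel a j \<Longrightarrow> sqshift a \<phi> \<in> sq_kernel a j"
  unfolding sq_kernel_def mem_Collect_eq
  by (metis sqshift_smooth_dom funpow_swap1 sqshift_zero)

context
  fixes \<sigma> :: complex
  assumes not_eigenvalue: "\<not> eigenvalue (domH K \<tau> H) (opH K \<tau>) \<sigma>"
begin

lemma det_sigma: "det (charmat \<sigma>) \<noteq> 0" "det (charmat (- \<sigma>)) \<noteq> 0"
  using not_eigenvalue by (simp_all add: eigenvalue_iff_det det_charmat_minus)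

lemma opR_injective:
  assumes "\<phi> \<in> domR K \<tau> H" "\<psi> \<in> domR K \<tau> H" "opR K \<tau> \<sigma> \<phi> = opR K \<tau> \<sigma> \<psi>"
  shows "\<phi> = \<psi>"
proof -
  let ?d = "\<phi> - \<psi>"
  have d: "?d \<in> domR K \<tau> H" using assms cfun.subspace_diff[OF subspace_domR] by blast
  have "sqshift (\<sigma> * \<sigma>) ?d = 0"
    using assms(3) unfolding sqshift_diff[OF assms(1,2)] opR_sqshift by simp
  then have "linshift \<sigma> (linshift (- \<sigma>) ?d) = 0"
    using sqshift_linshift[OF domR_C1[OF d]] by metis
  then have "linshift (- \<sigma>) ?d = 0"
    by (rule linshift_injective[OF det_sigma(1) linshift_domR[OF d]])
  then have "?d = 0"
    by (rule linshift_injective[OF det_sigma(2) domR_domH[OF d]])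
  then show ?thesis by simp
qed

lemma opR_surjective:
  assumes f: "f \<in> contfun (\<tau> K)"
  obtains \<phi> where "\<phi> \<in> domR K \<tau> H" "opR K \<tau> \<sigma> \<phi> = f"
proof -
  obtain y where y: "y \<in> domH K \<tau> H" "linshift \<sigma> y = f"
    using linshift_surjective[OF det_sigma(1) f] by blast
  have "y \<in> contfun (\<tau> K)"
    using y(1) unfolding domH_iff by (blast intro: C1funD(4))
  then obtain \<phi> where p: "\<phi> \<in> domH K \<tau> H" "linshift (- \<sigma>) \<phi> = y"
    using linshift_surjective[OF det_sigma(2)] by blast
  have "D \<phi> = y + cscale (- \<sigma>) \<phi>" using p(2) unfolding linshift_def by (simp only: diff_eq_eq)
  moreover have "y + cscale (- \<sigma>) \<phi> \<in> domH K \<tau> H"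
    by (intro cfun.subspace_add cfun.subspace_scale subspace_domH y(1) p(1))
  ultimately have "D \<phi> \<in> domH K \<tau> H" by (simp only:)
  then have R: "\<phi> \<in> domR K \<tau> H" using p(1) domR_iff by blast
  moreover have "opR K \<tau> \<sigma> \<phi> = f"
    unfolding opR_sqshift sqshift_linshift[OF domR_C1[OF R]] p(2) y(2) ..
  ultimately show thesis using that by blast
qed

lemma invR_eqI:
  assumes "\<phi> \<in> domR K \<tau> H" "opR K \<tau> \<sigma> \<phi> = f"
  shows "invR K \<tau> H \<sigma> f = \<phi>"
proof -
  have "inj_on (opR K \<tau> \<sigma>) (domR K \<tau> H)"
    by (rule inj_onI) (rule opR_injective)
  from inv_into_f_f[OF this assms(1)] show ?thesis
    unfolding invR_def assms(2) .
qed

lemma invR_opR: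
  assumes "f \<in> contfun (\<tau> K)"
  shows "invR K \<tau> H \<sigma> f \<in> domR K \<tau> H" "opR K \<tau> \<sigma> (invR K \<tau> H \<sigma> f) = f"
proof -
  obtain \<phi> where p: "\<phi> \<in> domR K \<tau> H" "opR K \<tau> \<sigma> \<phi> = f"
    by (rule opR_surjective[OF assms])
  show "invR K \<tau> H \<sigma> f \<in> domR K \<tau> H" "opR K \<tau> \<sigma> (invR K \<tau> H \<sigma> f) = f"
    unfolding invR_eqI[OF p] by (rule p)+
qed

lemma eigenspace_invR:
  assumes "\<mu> \<noteq> 0"
  shows "eigenspace (contfun (\<tau> K)) (invR K \<tau> H \<sigma>) \<mu> = {\<phi> \<in> domR K \<tau> H. sqshift (\<sigma>\<^sup>2 + 1 / \<mu>) \<phi> = 0}"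
proof (intro subset_antisym subsetI)
  fix \<phi> assume "\<phi> \<in> eigenspace (contfun (\<tau> K)) (invR K \<tau> H \<sigma>) \<mu>"
  then have p: "\<phi> \<in> contfun (\<tau> K)" "invR K \<tau> H \<sigma> \<phi> = cscale \<mu> \<phi>" by (auto simp: eigenspace_def)
  have R: "cscale \<mu> \<phi> \<in> domR K \<tau> H" "opR K \<tau> \<sigma> (cscale \<mu> \<phi>) = \<phi>"
    using invR_opR[OF p(1)] p(2) by auto
  have "cscale (1 / \<mu>) (cscale \<mu> \<phi>) \<in> domR K \<tau> H"
    using R(1) cfun.subspace_scale[OF subspace_domR] by blast
  then have D: "\<phi> \<in> domR K \<tau> H" using assms by simp
  have "cscale \<mu> (sqshift (\<sigma>\<^sup>2 + 1 / \<mu>) \<phi>) + cscale (1 / \<mu>) (cscale \<mu> \<phi>) = \<phi>"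
    using R(2) unfolding opR_sqshift_plus[OF refl, of _ _ "1 / \<mu>"] sqshift_cscale[OF D] .
  then have "sqshift (\<sigma>\<^sup>2 + 1 / \<mu>) \<phi> = 0" using assms by simp
  with D show "\<phi> \<in> {\<phi> \<in> domR K \<tau> H. sqshift (\<sigma>\<^sup>2 + 1 / \<mu>) \<phi> = 0}" by blast
next
  fix \<phi> assume "\<phi> \<in> {\<phi> \<in> domR K \<tau> H. sqshift (\<sigma>\<^sup>2 + 1 / \<mu>) \<phi> = 0}"
  then have p: "\<phi> \<in> domR K \<tau> H" "sqshift (\<sigma>\<^sup>2 + 1 / \<mu>) \<phi> = 0" by auto
  have "invR K \<tau> H \<sigma> \<phi> = cscale \<mu> \<phi>"
  proof (rule invR_eqI)
    show "cscale \<mu> \<phi> \<in> domR K \<tau> H" using p(1) cfun.subspace_scale[OF subspace_domR] by blast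
    show "opR K \<tau> \<sigma> (cscale \<mu> \<phi>) = \<phi>"
      unfolding opR_sqshift_plus[OF refl, of _ _ "1 / \<mu>"] sqshift_cscale[OF p(1)] p(2)
      using assms by simp
  qed
  then show "\<phi> \<in> eigenspace (contfun (\<tau> K)) (invR K \<tau> H \<sigma>) \<mu>"
    using domR_contfun[OF p(1)] by (simp add: eigenspace_def)
qed

lemma eigenvalue_invR_nonzero:
  assumes "eigenvalue (contfun (\<tau> K)) (invR K \<tau> H \<sigma>) \<mu>"
  shows "\<mu> \<noteq> 0"
proof
  assume "\<mu> = 0"
  then obtain \<phi> where p: "\<phi> \<in> contfun (\<tau> K)" "invR K \<tau> H \<sigma> \<phi> = 0" "\<phi> \<noteq> 0"
    using assms by (auto simp: eigenvalue_def eigenfunction_def eigenspace_def)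
  have "opR K \<tau> \<sigma> 0 = \<phi>" using invR_opR(2)[OF p(1)] p(2) by simp
  then show False using p(3) by (simp only: opR_sqshift sqshift_zero)
qed

text \<open>\<open>\<R>\<^sub>\<sigma>\<^sup>-\<^sup>1\<close> commutes with \<open>D\<^sup>2 - a = \<R>\<^sub>\<sigma> - \<rho>\<close>, so it preserves the kernels of the powers of the latter.\<close>

lemma invR_sq_kernel:
  assumes "a = \<sigma>\<^sup>2 + \<rho>" "\<phi> \<in> sq_kernel a j"
  shows "invR K \<tau> H \<sigma> \<phi> \<in> sq_kernel a j"
  using assms(2)
proof (induction j arbitrary: \<phi>)
  case 0
  have "\<phi> = 0" using 0 by (simp only: sq_kernel_def mem_Collect_eq funpow_0)
  moreover have "invR K \<tau> H \<sigma> 0 = 0"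
    using cfun.subspace_0[OF subspace_domR] by (rule invR_eqI) (simp only: opR_sqshift sqshift_zero)
  ultimately show ?case using 0 by (simp only:)
next
  case (Suc j)
  let ?x = "sqshift a \<phi>" and ?A = "invR K \<tau> H \<sigma>"
  have p: "\<phi> \<in> domR K \<tau> H" "?x \<in> sq_kernel a j" using Suc.prems sq_kernel_Suc by blast+
  have A: "?A \<phi> \<in> domR K \<tau> H" "opR K \<tau> \<sigma> (?A \<phi>) = \<phi>"
    using invR_opR[OF domR_contfun[OF p(1)]] by blast+
  have e: "sqshift a (?A \<phi>) = \<phi> - cscale \<rho> (?A \<phi>)"
    using A(2) unfolding opR_sqshift_plus[OF assms(1)] by (simp add: algebra_simps)
  have "?A ?x = \<phi> - cscale \<rho> (?A \<phi>)"
  proof (rule invR_eqI)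
    have c: "cscale \<rho> (?A \<phi>) \<in> domR K \<tau> H"
      using A(1) cfun.subspace_scale[OF subspace_domR] by blast
    then show "\<phi> - cscale \<rho> (?A \<phi>) \<in> domR K \<tau> H"
      using p(1) cfun.subspace_diff[OF subspace_domR] by blast
    have "opR K \<tau> \<sigma> (\<phi> - cscale \<rho> (?A \<phi>)) = opR K \<tau> \<sigma> \<phi> - cscale \<rho> (opR K \<tau> \<sigma> (?A \<phi>))"
      unfolding opR_sqshift sqshift_diff[OF p(1) c] sqshift_cscale[OF A(1)] ..
    then show "opR K \<tau> \<sigma> (\<phi> - cscale \<rho> (?A \<phi>)) = ?x"
      unfolding A(2) by (simp add: opR_sqshift_plus[OF assms(1)])
  qed
  then have "sqshift a (?A \<phi>) \<in> sq_kernel a j"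
    using Suc.IH[OF p(2)] e by (simp only:)
  then show ?case using A(1) sq_kernel_Suc by blast
qed

text \<open>On the domain of \<open>\<R>\<^sub>\<sigma>\<close> one has \<open>\<R>\<^sub>\<sigma>\<^sup>-\<^sup>1 - \<mu> = -\<mu> \<R>\<^sub>\<sigma>\<^sup>-\<^sup>1 (\<R>\<^sub>\<sigma> - 1/\<mu>)\<close>, and \<open>\<R>\<^sub>\<sigma>\<^sup>-\<^sup>1\<close> maps each of the kernels to
itself bijectively. A function in the left-hand kernel is in the domain because it is a combination of
two elements of the domain, its image under \<open>\<R>\<^sub>\<sigma>\<^sup>-\<^sup>1\<close> and an element of the previous kernel.\<close>

lemma ker_pow_invR:
  assumes "\<mu> \<noteq> 0" "a = \<sigma>\<^sup>2 + 1 / \<mu>"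
  shows "ker_pow (contfun (\<tau> K)) (invR K \<tau> H \<sigma>) \<mu> j = sq_kernel a j"
proof (induction j)
  case 0
  show ?case
    unfolding sq_kernel_def ker_pow.simps funpow_0
    using cfun.subspace_0[OF subspace_smooth_dom] by blast
next
  case (Suc j)
  let ?A = "invR K \<tau> H \<sigma>"
  note scale = cfun.subspace_scale[OF subspace_sq_kernel]
  have "\<phi> \<in> sq_kernel a (Suc j)" if p: "\<phi> \<in> contfun (\<tau> K)" and k: "?A \<phi> - cscale \<mu> \<phi> \<in> sq_kernel a j" for \<phi>
  proof -
    define y where "y = ?A \<phi> - cscale \<mu> \<phi>"
    have y: "y \<in> sq_kernel a j" "y \<in> domR K \<tau> H"
      using k smooth_dom_domR by (auto simp: y_def sq_kernel_def)
    have A: "?A \<phi> \<in> domR K \<tau> H" "opR K \<tau> \<sigma> (?A \<phi>) = \<phi>" using invR_opR[OF p] by blast+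
    have "cscale (1 / \<mu>) (?A \<phi> - y) \<in> domR K \<tau> H"
      using A(1) y(2) cfun.subspace_diff[OF subspace_domR] cfun.subspace_scale[OF subspace_domR] by blast
    then have D: "\<phi> \<in> domR K \<tau> H" using assms(1) by (simp add: y_def)
    then have D': "cscale \<mu> \<phi> \<in> domR K \<tau> H" using cfun.subspace_scale[OF subspace_domR] by blast
    have "opR K \<tau> \<sigma> y = \<phi> - cscale \<mu> (opR K \<tau> \<sigma> \<phi>)"
      using A(2) unfolding y_def opR_sqshift sqshift_diff[OF A(1) D'] sqshift_cscale[OF D] by simp
    also have "\<dots> = cscale (- \<mu>) (sqshift a \<phi>)"
      unfolding opR_sqshift_plus[OF assms(2)] using assms(1)
      by (simp add: cfun.scale_right_distrib cfun.scale_minus_left)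
    finally have "sqshift a \<phi> = cscale (- 1 / \<mu>) (opR K \<tau> \<sigma> y)"
      using assms(1) by simp
    moreover have "opR K \<tau> \<sigma> y \<in> sq_kernel a j"
      unfolding opR_sqshift_plus[OF assms(2)]
      using y(1) sqshift_sq_kernel scale cfun.subspace_add[OF subspace_sq_kernel] by blast
    ultimately have "sqshift a \<phi> \<in> sq_kernel a j" by (simp only: scale)
    then show ?thesis using D sq_kernel_Suc by blast
  qed
  moreover have "\<phi> \<in> contfun (\<tau> K) \<and> ?A \<phi> - cscale \<mu> \<phi> \<in> sq_kernel a j" if k: "\<phi> \<in> sq_kernel a (Suc j)" for \<phi>
  proof -
    have D: "\<phi> \<in> domR K \<tau> H" and s: "sqshift a \<phi> \<in> sq_kernel a j" using k sq_kernel_Suc by blast+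
    have A: "?A \<phi> \<in> domR K \<tau> H" "opR K \<tau> \<sigma> (?A \<phi>) = \<phi>"
      using invR_opR[OF domR_contfun[OF D]] by blast+
    have c: "cscale (1 / \<mu>) (?A \<phi>) \<in> domR K \<tau> H"
      using A(1) cfun.subspace_scale[OF subspace_domR] by blast
    have "?A (sqshift a \<phi>) = \<phi> - cscale (1 / \<mu>) (?A \<phi>)"
    proof (rule invR_eqI)
      show "\<phi> - cscale (1 / \<mu>) (?A \<phi>) \<in> domR K \<tau> H"
        using D c cfun.subspace_diff[OF subspace_domR] by blast
      have "opR K \<tau> \<sigma> (\<phi> - cscale (1 / \<mu>) (?A \<phi>)) = opR K \<tau> \<sigma> \<phi> - cscale (1 / \<mu>) (opR K \<tau> \<sigma> (?A \<phi>))"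
        unfolding opR_sqshift sqshift_diff[OF D c] sqshift_cscale[OF A(1)] ..
      then show "opR K \<tau> \<sigma> (\<phi> - cscale (1 / \<mu>) (?A \<phi>)) = sqshift a \<phi>"
        unfolding A(2) by (simp add: opR_sqshift_plus[OF assms(2)])
    qed
    then have "?A \<phi> - cscale \<mu> \<phi> = cscale (- \<mu>) (?A (sqshift a \<phi>))"
      using assms(1) by (simp add: cfun.scale_right_diff_distrib cfun.scale_minus_left)
    then show ?thesis
      using scale[OF invR_sq_kernel[OF assms(2) s]] domR_contfun[OF D] by (simp only: simp_thms)
  qed
  ultimately show ?case unfolding ker_pow.simps Suc by blast
qed

lemma eigenvalue_invRI:
  assumes "eigenvalue (domH K \<tau> H) (opH K \<tau>) \<nu>"
  shows "\<nu>\<^sup>2 \<noteq> \<sigma>\<^sup>2" "eigenvalue (contfun (\<tau> K)) (invR K \<tau> H \<sigma>) (1 / (\<nu>\<^sup>2 - \<sigma>\<^sup>2))"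
proof -
  show ne: "\<nu>\<^sup>2 \<noteq> \<sigma>\<^sup>2"
    using assms not_eigenvalue eigenvalue_minus by (auto simp: power2_eq_iff)
  obtain \<phi> where p: "\<phi> \<in> domH K \<tau> H" "D \<phi> = cscale \<nu> \<phi>" "\<phi> \<noteq> 0"
    using assms by (auto simp: eigenvalue_def eigenfunction_def eigenspace_def opH_def)
  have R: "\<phi> \<in> domR K \<tau> H"
    using p(1,2) cfun.subspace_scale[OF subspace_domH] by (simp only: domR_iff simp_thms)
  have "sqshift (\<nu>\<^sup>2) \<phi> = 0"
    unfolding sqshift_def p(2) C1fun_cscale(2)[OF domR_C1(1)[OF R]]
    by (simp add: p(2) power2_eq_square)
  then have "\<phi> \<in> eigenspace (contfun (\<tau> K)) (invR K \<tau> H \<sigma>) (1 / (\<nu>\<^sup>2 - \<sigma>\<^sup>2))"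
    using R ne by (subst eigenspace_invR) auto
  then show "eigenvalue (contfun (\<tau> K)) (invR K \<tau> H \<sigma>) (1 / (\<nu>\<^sup>2 - \<sigma>\<^sup>2))"
    using p(3) by (auto simp: eigenvalue_def eigenfunction_def)
qed

lemma eigenvalue_invRD:
  assumes "eigenvalue (contfun (\<tau> K)) (invR K \<tau> H \<sigma>) \<mu>"
  shows "eigenvalue (domH K \<tau> H) (opH K \<tau>) (csqrt (1 / \<mu> + \<sigma>\<^sup>2))"
proof (rule ccontr)
  define r where "r = csqrt (1 / \<mu> + \<sigma>\<^sup>2)"
  have r: "\<sigma>\<^sup>2 + 1 / \<mu> = r * r"
    using power2_csqrt[of "1 / \<mu> + \<sigma>\<^sup>2"] by (simp add: r_def power2_eq_square)
  assume "\<not> eigenvalue (domH K \<tau> H) (opH K \<tau>) (csqrt (1 / \<mu> + \<sigma>\<^sup>2))"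
  then have det: "det (charmat r) \<noteq> 0" "det (charmat (- r)) \<noteq> 0"
    by (simp_all add: eigenvalue_iff_det det_charmat_minus r_def)
  obtain \<phi> where p: "\<phi> \<in> domR K \<tau> H" "sqshift (r * r) \<phi> = 0" "\<phi> \<noteq> 0"
    using assms eigenspace_invR[OF eigenvalue_invR_nonzero[OF assms]]
    unfolding eigenvalue_def eigenfunction_def r by blast
  have "linshift r (linshift (- r) \<phi>) = 0"
    using p(2) sqshift_linshift[OF domR_C1[OF p(1)]] by metis
  then have "linshift (- r) \<phi> = 0"
    by (rule linshift_injective[OF det(1) linshift_domR[OF p(1)]])
  then have "\<phi> = 0"
    by (rule linshift_injective[OF det(2) domR_domH[OF p(1)]])
  with p(3) show False by simp
qed

text \<open>For \<open>\<phi>\<close> in the eigenspace, \<open>(\<H> + \<nu>) \<phi>\<close> and \<open>(\<H> - \<nu>) \<phi>\<close> are multiples of the two given eigenfunctions,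
and their difference is \<open>2\<nu>\<phi>\<close>.\<close>

lemma eigenspace_invR_simple:
  assumes "\<nu> \<noteq> 0"
    and sp: "simple_eigenvalue (domH K \<tau> H) (opH K \<tau>) \<nu>"
    and sm: "simple_eigenvalue (domH K \<tau> H) (opH K \<tau>) (- \<nu>)"
    and ep: "eigenfunction (domH K \<tau> H) (opH K \<tau>) \<nu> \<phi>p"
    and em: "eigenfunction (domH K \<tau> H) (opH K \<tau>) (- \<nu>) \<phi>m"
  shows "eigenspace (contfun (\<tau> K)) (invR K \<tau> H \<sigma>) (1 / (\<nu>\<^sup>2 - \<sigma>\<^sup>2)) = cfun.span {\<phi>p, \<phi>m}"
proof -
  have ne: "\<nu>\<^sup>2 \<noteq> \<sigma>\<^sup>2"
    using eigenvalue_invRI(1) sp by (simp add: simple_eigenvalue_def)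
  define E where "E = {\<phi> \<in> domR K \<tau> H. sqshift (\<nu> * \<nu>) \<phi> = 0}"
  have E: "eigenspace (contfun (\<tau> K)) (invR K \<tau> H \<sigma>) (1 / (\<nu>\<^sup>2 - \<sigma>\<^sup>2)) = E"
    using ne by (subst eigenspace_invR) (auto simp: E_def power2_eq_square)
  have subE: "cfun.subspace E"
  proof (rule cfun.subspaceI)
    show "0 \<in> E"
      using cfun.subspace_0[OF subspace_domR] by (simp only: E_def mem_Collect_eq sqshift_zero simp_thms)
    show "x + y \<in> E" if "x \<in> E" "y \<in> E" for x y
      using that cfun.subspace_add[OF subspace_domR] by (simp only: E_def mem_Collect_eq sqshift_add add_0 simp_thms)
    show "cscale c x \<in> E" if "x \<in> E" for c x
      using that cfun.subspace_scale[OF subspace_domR]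
      by (simp only: E_def mem_Collect_eq sqshift_cscale cfun.scale_zero_right simp_thms)
  qed
  have lin_0: "x \<in> eigenspace (domH K \<tau> H) (opH K \<tau>) \<alpha> \<longleftrightarrow> x \<in> domH K \<tau> H \<and> linshift \<alpha> x = 0" for x \<alpha>
    by (simp add: eigenspace_def opH_def linshift_eq_0_iff)
  have inE: "x \<in> E" if "x \<in> eigenspace (domH K \<tau> H) (opH K \<tau>) \<alpha>" "\<alpha> * \<alpha> = \<nu> * \<nu>" for x \<alpha>
  proof -
    have x: "x \<in> domH K \<tau> H" "D x = cscale \<alpha> x" using that(1) by (auto simp: eigenspace_def opH_def)
    then have R: "x \<in> domR K \<tau> H"
      using cfun.subspace_scale[OF subspace_domH] by (simp only: domR_iff simp_thms)
    have "sqshift (\<nu> * \<nu>) x = 0"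
      unfolding sqshift_def x(2) C1fun_cscale(2)[OF domR_C1(1)[OF R]]
      by (simp add: x(2) that(2))
    with R show ?thesis by (simp add: E_def)
  qed
  have "\<phi>p \<in> E" "\<phi>m \<in> E"
    using inE[of \<phi>p \<nu>] inE[of \<phi>m "- \<nu>"] ep em by (auto simp: eigenfunction_def)
  then have "cfun.span {\<phi>p, \<phi>m} \<subseteq> E"
    using subE by (intro cfun.span_minimal) auto
  moreover have "E \<subseteq> cfun.span {\<phi>p, \<phi>m}"
  proof
    fix \<phi> assume "\<phi> \<in> E"
    then have p: "\<phi> \<in> domR K \<tau> H" "sqshift (\<nu> * \<nu>) \<phi> = 0" by (auto simp: E_def)
    have "linshift \<nu> (linshift (- \<nu>) \<phi>) = 0" "linshift (- \<nu>) (linshift \<nu> \<phi>) = 0"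
      using p(2) sqshift_linshift[OF domR_C1[OF p(1)], of \<nu>] sqshift_linshift[OF domR_C1[OF p(1)], of "- \<nu>"]
      by simp_all
    then have "linshift (- \<nu>) \<phi> \<in> cfun.span {\<phi>p}" "linshift \<nu> \<phi> \<in> cfun.span {\<phi>m}"
      using lin_0 linshift_domR[OF p(1)] eigenspace_simple[OF sp ep] eigenspace_simple[OF sm em] by blast+
    then have in_span: "linshift (- \<nu>) \<phi> \<in> cfun.span {\<phi>p, \<phi>m}" "linshift \<nu> \<phi> \<in> cfun.span {\<phi>p, \<phi>m}"
      using cfun.span_mono[of "{\<phi>p}" "{\<phi>p, \<phi>m}"] cfun.span_mono[of "{\<phi>m}" "{\<phi>p, \<phi>m}"] by auto
    have "linshift (- \<nu>) \<phi> - linshift \<nu> \<phi> = cscale \<nu> \<phi> + cscale \<nu> \<phi>"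
      unfolding linshift_def by (simp add: cfun.scale_minus_left)
    also have "\<dots> = cscale (2 * \<nu>) \<phi>"
      by (simp only: mult_2 cfun.scale_left_distrib)
    finally have e: "\<phi> = cscale (1 / (2 * \<nu>)) (linshift (- \<nu>) \<phi> - linshift \<nu> \<phi>)"
      using assms(1) by simp
    show "\<phi> \<in> cfun.span {\<phi>p, \<phi>m}"
      by (subst e) (intro cfun.span_scale cfun.span_diff in_span)
  qed
  ultimately show ?thesis unfolding E by blast
qed

lemma even_alg_mult_invR:
  assumes "eigenvalue (contfun (\<tau> K)) (invR K \<tau> H \<sigma>) \<mu>"
  shows "\<exists>m. alg_mult (contfun (\<tau> K)) (invR K \<tau> H \<sigma>) \<mu> = enat (2 * m)"
proof -
  define a where "a = \<sigma>\<^sup>2 + 1 / \<mu>"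
  obtain N where N: "(\<Union>j. sq_kernel a j) = sq_kernel a N"
    using sq_kernel_stabilises[OF det_sigma(1)] by blast
  have G: "(\<Union>j. ker_pow (contfun (\<tau> K)) (invR K \<tau> H \<sigma>) \<mu> j) = sq_kernel a N"
    unfolding ker_pow_invR[OF eigenvalue_invR_nonzero[OF assms] a_def] by (rule N)
  obtain S :: "(real \<Rightarrow> complex^('n+'n)) set" where S: "finite S" "ksolset a N \<subseteq> cfun.span S"
    using ksolset_finite_dim by blast
  obtain C where C: "C \<subseteq> sq_kernel a N" "cfun.independent C" "sq_kernel a N \<subseteq> cfun.span C"
    by (rule cfun.basis_exists)
  have "C \<subseteq> cfun.span S"
    using C(1) S(2) sq_kernel_subset[of a N] by blast
  then have "finite C"
    using cfun.independent_span_bound[OF S(1) C(2)] by blast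
  moreover have "cfun.span C = sq_kernel a N"
    using C(3) cfun.span_minimal[OF C(1) subspace_sq_kernel] by blast
  ultimately have "\<exists>B. finite B \<and> cfun.span B = sq_kernel a N"
    by blast
  then have "alg_mult (contfun (\<tau> K)) (invR K \<tau> H \<sigma>) \<mu> = enat (cfun.dim (sq_kernel a N))"
    unfolding alg_mult_def G Let_def by (simp only: if_True)
  moreover obtain m where "cfun.dim (sq_kernel a N) = 2 * m"
    using even_dim_sq_kernel[of a N] by (rule evenE)
  ultimately show ?thesis by auto
qed

end

end

theorem proposition3p3:
  fixes K :: nat and \<tau> :: "nat \<Rightarrow> real"
    and H :: "int \<Rightarrow> real ^ ('n::finite + 'n) ^ ('n + 'n)" and \<sigma> :: complex
  assumes "K \<ge> 1" and "0 < \<tau> 1" and "strict_mono_on {1..K} \<tau>"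
    and "transpose (symplJ ** H 0) = symplJ ** H 0"
    and "\<And>k. k \<in> {1..K} \<Longrightarrow> transpose (symplJ ** H (- int k)) = symplJ ** H (int k)"
    and "\<not> eigenvalue (domH K \<tau> H) (opH K \<tau>) \<sigma>"
  shows
    "(\<forall>\<nu>. eigenvalue (domH K \<tau> H) (opH K \<tau>) \<nu> \<longrightarrow>
        eigenvalue (contfun (\<tau> K)) (invR K \<tau> H \<sigma>) (1 / (\<nu>\<^sup>2 - \<sigma>\<^sup>2)))
   \<and> (\<forall>\<mu>. eigenvalue (contfun (\<tau> K)) (invR K \<tau> H \<sigma>) \<mu> \<longrightarrow>
        eigenvalue (domH K \<tau> H) (opH K \<tau>) (csqrt (1 / \<mu> + \<sigma>\<^sup>2)) \<and>
        eigenvalue (domH K \<tau> H) (opH K \<tau>) (- csqrt (1 / \<mu> + \<sigma>\<^sup>2)))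
   \<and> (\<forall>\<nu> \<phi>p \<phi>m. \<nu> \<noteq> 0 \<longrightarrow>
        simple_eigenvalue (domH K \<tau> H) (opH K \<tau>) \<nu> \<longrightarrow>
        simple_eigenvalue (domH K \<tau> H) (opH K \<tau>) (- \<nu>) \<longrightarrow>
        eigenfunction (domH K \<tau> H) (opH K \<tau>) \<nu> \<phi>p \<longrightarrow>
        eigenfunction (domH K \<tau> H) (opH K \<tau>) (- \<nu>) \<phi>m \<longrightarrow>
        eigenspace (contfun (\<tau> K)) (invR K \<tau> H \<sigma>) (1 / (\<nu>\<^sup>2 - \<sigma>\<^sup>2)) = cfun.span {\<phi>p, \<phi>m})
   \<and> (\<forall>\<mu>. eigenvalue (contfun (\<tau> K)) (invR K \<tau> H \<sigma>) \<mu> \<longrightarrow>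
        (\<exists>m. alg_mult (contfun (\<tau> K)) (invR K \<tau> H \<sigma>) \<mu> = enat (2 * m)))"
proof -
  interpret hamiltonian_delay K \<tau> H
    using assms(1-5) by unfold_locales
  note nev = assms(6)
  show ?thesis
  proof (intro conjI allI impI)
    fix \<mu> assume "eigenvalue (contfun (\<tau> K)) (invR K \<tau> H \<sigma>) \<mu>"
    then show ev: "eigenvalue (domH K \<tau> H) (opH K \<tau>) (csqrt (1 / \<mu> + \<sigma>\<^sup>2))"
      by (rule eigenvalue_invRD[OF nev])
    then show "eigenvalue (domH K \<tau> H) (opH K \<tau>) (- csqrt (1 / \<mu> + \<sigma>\<^sup>2))"
      unfolding eigenvalue_minus .
  qed (rule eigenvalue_invRI(2)[OF nev] eigenspace_invR_simple[OF nev] even_alg_mult_invR[OF nev]; assumption)+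
qed

end
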